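(* Let $A$ be an arbitrary unital algebra over a field $F$, let $B$ be a central simple $F$-algebra (of finite or infinite dimension), and let $T=A\otimes_F B$. Then for every $t\in T$ there exist $a\in A$ and $s\in T$ such that: (1) $t=a\otimes 1+s$; (2) $s$ is centrally stable in $T$; (3) if $a$ is centrally stable in $A$, then $t$ is centrally stable in $T$.
   Context: All algebras are associative algebras over a field $F$. $Z(A)$ denotes the center of an algebra $A$. An element $a$ of an algebra $A$ is called centrally stable (in $A$) if, for every algebra epimorphism (i.e. surjective algebra homomorphism) $\varphi:A\to B$ onto an algebra $B$, $\varphi(a)\in Z(B)$ implies $a\in Z(A)+\ker\varphi$. An algebra is central if it is unital and its center consists of the scalar multiples of unity; a central simple algebra is one that is both central and simple. *)

theory Defs
  imports "HOL-Algebra.QuotRing" "HOL-Algebra.Module" "HOL.Hull"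
begin

section \<open>Associative algebras over a field\<close>

text \<open>
  The library locale \<^locale>\<open>algebra\<close> is restricted to commutative unital algebras. Here algebras
  are associative but neither commutative nor unital in general; the component \<open>one\<close> of the record
  carries no meaning unless the algebra is unital. The zero algebra counts as unital.
\<close>

locale assoc_algebra = module F A + field F for F (structure) and A (structure) +
  assumes mult_closed: "\<lbrakk>x \<in> carrier A; y \<in> carrier A\<rbrakk> \<Longrightarrow> x \<otimes>\<^bsub>A\<^esub> y \<in> carrier A"
    and mult_assoc: "\<lbrakk>x \<in> carrier A; y \<in> carrier A; z \<in> carrier A\<rbrakk> \<Longrightarrow>
      (x \<otimes>\<^bsub>A\<^esub> y) \<otimes>\<^bsub>A\<^esub> z = x \<otimes>\<^bsub>A\<^esub> (y \<otimes>\<^bsub>A\<^esub> z)"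
    and mult_l_distr: "\<lbrakk>x \<in> carrier A; y \<in> carrier A; z \<in> carrier A\<rbrakk> \<Longrightarrow>
      (x \<oplus>\<^bsub>A\<^esub> y) \<otimes>\<^bsub>A\<^esub> z = x \<otimes>\<^bsub>A\<^esub> z \<oplus>\<^bsub>A\<^esub> y \<otimes>\<^bsub>A\<^esub> z"
    and mult_r_distr: "\<lbrakk>x \<in> carrier A; y \<in> carrier A; z \<in> carrier A\<rbrakk> \<Longrightarrow>
      z \<otimes>\<^bsub>A\<^esub> (x \<oplus>\<^bsub>A\<^esub> y) = z \<otimes>\<^bsub>A\<^esub> x \<oplus>\<^bsub>A\<^esub> z \<otimes>\<^bsub>A\<^esub> y"
    and smult_mult_left: "\<lbrakk>c \<in> carrier F; x \<in> carrier A; y \<in> carrier A\<rbrakk> \<Longrightarrow>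
      (c \<odot>\<^bsub>A\<^esub> x) \<otimes>\<^bsub>A\<^esub> y = c \<odot>\<^bsub>A\<^esub> (x \<otimes>\<^bsub>A\<^esub> y)"
    and smult_mult_right: "\<lbrakk>c \<in> carrier F; x \<in> carrier A; y \<in> carrier A\<rbrakk> \<Longrightarrow>
      x \<otimes>\<^bsub>A\<^esub> (c \<odot>\<^bsub>A\<^esub> y) = c \<odot>\<^bsub>A\<^esub> (x \<otimes>\<^bsub>A\<^esub> y)"

locale unital_algebra = assoc_algebra F A + A?: monoid A for F (structure) and A (structure)

definition center :: "('a, 'm) monoid_scheme \<Rightarrow> 'a set" where
  "center A = {z \<in> carrier A. \<forall>x \<in> carrier A. z \<otimes>\<^bsub>A\<^esub> x = x \<otimes>\<^bsub>A\<^esub> z}"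

definition algebra_hom ::
  "('f, 'r) ring_scheme \<Rightarrow> ('f, 'a, 'm) module_scheme \<Rightarrow> ('f, 'b, 'n) module_scheme \<Rightarrow> ('a \<Rightarrow> 'b) set"
  where
  "algebra_hom F A B = {\<phi> \<in> hom A B \<inter> hom (add_monoid A) (add_monoid B).
     \<forall>c \<in> carrier F. \<forall>x \<in> carrier A. \<phi> (c \<odot>\<^bsub>A\<^esub> x) = c \<odot>\<^bsub>B\<^esub> \<phi> x}"

definition algebra_epi ::
  "('f, 'r) ring_scheme \<Rightarrow> ('f, 'a, 'm) module_scheme \<Rightarrow> ('f, 'b, 'n) module_scheme \<Rightarrow> ('a \<Rightarrow> 'b) set"
  where
  "algebra_epi F A B = {\<phi> \<in> algebra_hom F A B. \<phi> ` carrier A = carrier B}"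

definition algebra_ideal :: "('f, 'r) ring_scheme \<Rightarrow> ('f, 'a, 'm) module_scheme \<Rightarrow> 'a set \<Rightarrow> bool" where
  "algebra_ideal F A I \<longleftrightarrow> submodule I F A \<and>
     (\<forall>x \<in> carrier A. \<forall>y \<in> I. x \<otimes>\<^bsub>A\<^esub> y \<in> I \<and> y \<otimes>\<^bsub>A\<^esub> x \<in> I)"

definition simple_algebra :: "('f, 'r) ring_scheme \<Rightarrow> ('f, 'a, 'm) module_scheme \<Rightarrow> bool" where
  "simple_algebra F A \<longleftrightarrow> assoc_algebra F A \<and>
     (\<exists>x \<in> carrier A. \<exists>y \<in> carrier A. x \<otimes>\<^bsub>A\<^esub> y \<noteq> \<zero>\<^bsub>A\<^esub>) \<and>
     (\<forall>I. algebra_ideal F A I \<longrightarrow> I = {\<zero>\<^bsub>A\<^esub>} \<or> I = carrier A)"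

definition central_algebra :: "('f, 'r) ring_scheme \<Rightarrow> ('f, 'a, 'm) module_scheme \<Rightarrow> bool" where
  "central_algebra F A \<longleftrightarrow> unital_algebra F A \<and>
     center A = (\<lambda>c. c \<odot>\<^bsub>A\<^esub> \<one>\<^bsub>A\<^esub>) ` carrier F"

definition central_simple_algebra :: "('f, 'r) ring_scheme \<Rightarrow> ('f, 'a, 'm) module_scheme \<Rightarrow> bool" where
  "central_simple_algebra F A \<longleftrightarrow> central_algebra F A \<and> simple_algebra F A"


section \<open>Centrally stable elements\<close>

text \<open>
  A definition cannot quantify over the type of the codomain \<open>B\<close>. Up to isomorphism every
  epimorphic image of \<open>A\<close> is a quotient of \<open>A\<close>, hence lives on a set of subsets of \<open>A\<close>. The lemma
  \<open>centrally_stableD\<close> below removes the restriction on the type.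
\<close>

definition centrally_stable :: "('f, 'r) ring_scheme \<Rightarrow> ('f, 'a, 'm) module_scheme \<Rightarrow> 'a \<Rightarrow> bool" where
  "centrally_stable F A a \<longleftrightarrow> a \<in> carrier A \<and>
     (\<forall>(B :: ('f, 'a set) module) \<phi>.
        assoc_algebra F B \<and> \<phi> \<in> algebra_epi F A B \<and> \<phi> a \<in> center B \<longrightarrow>
        a \<in> center A <+>\<^bsub>A\<^esub> a_kernel A B \<phi>)"

lemma assoc_algebra_transport:
  fixes F :: "('f, 'r) ring_scheme" and B :: "('f, 'b, 'n) module_scheme" and g :: "'b \<Rightarrow> 'c"
  assumes B: "assoc_algebra F B" and h: "\<And>b. b \<in> carrier B \<Longrightarrow> h (g b) = b"
  defines "C \<equiv> \<lparr>carrier = g ` carrier B, mult = (\<lambda>x y. g (h x \<otimes>\<^bsub>B\<^esub> h y)), one = g \<one>\<^bsub>B\<^esub>,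
    zero = g \<zero>\<^bsub>B\<^esub>, add = (\<lambda>x y. g (h x \<oplus>\<^bsub>B\<^esub> h y)), smult = (\<lambda>c x. g (c \<odot>\<^bsub>B\<^esub> h x))\<rparr>"
  shows "assoc_algebra F C"
proof -
  interpret B: assoc_algebra F B by fact
  have "abelian_group C"
  proof (rule abelian_groupI)
    fix x assume "x \<in> carrier C"
    then obtain b where b: "b \<in> carrier B" "x = g b" by (auto simp: C_def)
    then show "\<exists>y\<in>carrier C. y \<oplus>\<^bsub>C\<^esub> x = \<zero>\<^bsub>C\<^esub>"
      by (intro bexI[of _ "g (\<ominus>\<^bsub>B\<^esub> b)"]) (auto simp: C_def h B.M.l_neg)
  qed (auto simp: C_def h B.M.a_ac)
  then show ?thesis
    by (intro assoc_algebra.intro assoc_algebra_axioms.intro module.intro module_axioms.intro)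
      (auto simp: C_def h B.mult_closed B.mult_assoc B.mult_l_distr B.mult_r_distr
        B.smult_mult_left B.smult_mult_right B.smult_l_distr B.smult_r_distr B.smult_assoc1
        B.R.is_cring B.field_axioms)
qed

lemma centrally_stableD:
  fixes F :: "('f, 'r) ring_scheme" and A :: "('f, 'a, 'm) module_scheme"
    and B :: "('f, 'b, 'n) module_scheme"
  assumes a: "centrally_stable F A a" and B: "assoc_algebra F B"
    and \<phi>: "\<phi> \<in> algebra_epi F A B" and c: "\<phi> a \<in> center B"
  shows "a \<in> center A <+>\<^bsub>A\<^esub> a_kernel A B \<phi>"
proof -
  interpret B: assoc_algebra F B by fact
  define g where "g b = {x \<in> carrier A. \<phi> x = b}" for b
  define h where "h X = \<phi> (SOME x. x \<in> X)" for X
  have h: "h (g b) = b" if "b \<in> carrier B" for b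
  proof -
    have "b \<in> \<phi> ` carrier A" using \<phi> that by (simp add: algebra_epi_def)
    then have "\<exists>x. x \<in> g b" by (auto simp: g_def)
    then have "(SOME x. x \<in> g b) \<in> g b" by (rule someI_ex)
    then show ?thesis by (simp add: h_def g_def)
  qed
  define C :: "('f, 'a set) module" where
    "C = \<lparr>carrier = g ` carrier B, mult = (\<lambda>x y. g (h x \<otimes>\<^bsub>B\<^esub> h y)), one = g \<one>\<^bsub>B\<^esub>,
    zero = g \<zero>\<^bsub>B\<^esub>, add = (\<lambda>x y. g (h x \<oplus>\<^bsub>B\<^esub> h y)), smult = (\<lambda>c x. g (c \<odot>\<^bsub>B\<^esub> h x))\<rparr>"
  have C: "assoc_algebra F C"
    unfolding C_def by (rule assoc_algebra_transport[where h = h and g = g, OF B h])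
  have \<phi>c: "\<phi> x \<in> carrier B" if "x \<in> carrier A" for x
    using \<phi> that by (auto simp: algebra_epi_def)
  have "\<phi> ` carrier A = carrier B" using \<phi> by (simp add: algebra_epi_def)
  then have "g ` \<phi> ` carrier A = carrier C" by (simp add: C_def)
  then have "(g \<circ> \<phi>) ` carrier A = carrier C" by (simp only: image_comp)
  moreover have "(g \<circ> \<phi>) \<in> algebra_hom F A C"
    using \<phi> by (auto simp: algebra_epi_def algebra_hom_def hom_def C_def h \<phi>c)
  ultimately have epi: "(g \<circ> \<phi>) \<in> algebra_epi F A C" by (simp add: algebra_epi_def)
  have "(g \<circ> \<phi>) a \<in> center C"
    using c by (auto simp: center_def C_def h)
  then have "a \<in> center A <+>\<^bsub>A\<^esub> a_kernel A C (g \<circ> \<phi>)"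
    using a C epi unfolding centrally_stable_def by blast
  moreover have "a_kernel A C (g \<circ> \<phi>) = a_kernel A B \<phi>"
  proof -
    have "g (\<phi> x) = g \<zero>\<^bsub>B\<^esub> \<longleftrightarrow> \<phi> x = \<zero>\<^bsub>B\<^esub>" if "x \<in> carrier A" for x
      using h[OF \<phi>c[OF that]] h[OF B.M.zero_closed] by metis
    then show ?thesis by (auto simp: a_kernel_def kernel_def C_def)
  qed
  ultimately show ?thesis by simp
qed


section \<open>Tensor products of algebras\<close>

text \<open>
  The semigroup algebra of \<open>G\<close>: functions with finite support, i.e. formal linear combinations of
  elements of \<open>G\<close>, with the bilinear extension of the multiplication of \<open>G\<close>.
\<close>

definition semigroup_algebra ::
  "('f, 'r) ring_scheme \<Rightarrow> ('g, 'm) monoid_scheme \<Rightarrow> ('f, 'g \<Rightarrow> 'f) module" where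
  "semigroup_algebra F G =
    \<lparr>carrier = {f. (\<forall>p. f p \<in> carrier F) \<and> finite {p. f p \<noteq> \<zero>\<^bsub>F\<^esub>} \<and> {p. f p \<noteq> \<zero>\<^bsub>F\<^esub>} \<subseteq> carrier G},
     mult = (\<lambda>f g p. \<Oplus>\<^bsub>F\<^esub>q\<in>{q. f q \<noteq> \<zero>\<^bsub>F\<^esub>}. \<Oplus>\<^bsub>F\<^esub>r\<in>{r. g r \<noteq> \<zero>\<^bsub>F\<^esub>}.
               if q \<otimes>\<^bsub>G\<^esub> r = p then f q \<otimes>\<^bsub>F\<^esub> g r else \<zero>\<^bsub>F\<^esub>),
     one = (\<lambda>p. if p = \<one>\<^bsub>G\<^esub> then \<one>\<^bsub>F\<^esub> else \<zero>\<^bsub>F\<^esub>),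
     zero = (\<lambda>p. \<zero>\<^bsub>F\<^esub>),
     add = (\<lambda>f g p. f p \<oplus>\<^bsub>F\<^esub> g p),
     smult = (\<lambda>c f p. c \<otimes>\<^bsub>F\<^esub> f p)\<rparr>"

definition basis_elem :: "('f, 'r) ring_scheme \<Rightarrow> 'g \<Rightarrow> 'g \<Rightarrow> 'f" where
  "basis_elem F p = (\<lambda>q. if q = p then \<one>\<^bsub>F\<^esub> else \<zero>\<^bsub>F\<^esub>)"

definition quotient_algebra :: "('f, 'a, 'm) module_scheme \<Rightarrow> 'a set \<Rightarrow> ('f, 'a set) module" where
  "quotient_algebra M N = ring.extend (M Quot N)
     (module.fields (\<lambda>c X. \<Union>x\<in>X. N +>\<^bsub>M\<^esub> (c \<odot>\<^bsub>M\<^esub> x)))"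

text \<open>
  As a vector space, \<open>A \<otimes> B\<close> is the free vector space on the set \<open>A \<times> B\<close> modulo the subspace spanned
  by the bilinearity relations. The free vector space is the semigroup algebra of the multiplicative
  semigroup \<open>A \<times> B\<close>; its multiplication, which sends the pairs \<open>(a, b)\<close>, \<open>(a', b')\<close> to
  \<open>(a a', b b')\<close>, induces the multiplication of \<open>A \<otimes> B\<close>, because the span of the relations
  absorbs multiplication by pairs and hence is an ideal.
\<close>

definition free_pairs ::
  "('f, 'r) ring_scheme \<Rightarrow> ('f, 'a, 'm) module_scheme \<Rightarrow> ('f, 'b, 'n) module_scheme \<Rightarrow>
   ('f, 'a \<times> 'b \<Rightarrow> 'f) module" where
  "free_pairs F A B = semigroup_algebra F (A \<times>\<times> B)"

inductive_set bilinear_relations ::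
  "('f, 'r) ring_scheme \<Rightarrow> ('f, 'a, 'm) module_scheme \<Rightarrow> ('f, 'b, 'n) module_scheme \<Rightarrow>
   ('a \<times> 'b \<Rightarrow> 'f) set" for F A B where
  add_left: "\<lbrakk>a \<in> carrier A; a' \<in> carrier A; b \<in> carrier B\<rbrakk> \<Longrightarrow>
    basis_elem F (a \<oplus>\<^bsub>A\<^esub> a', b)
      \<ominus>\<^bsub>free_pairs F A B\<^esub> (basis_elem F (a, b) \<oplus>\<^bsub>free_pairs F A B\<^esub> basis_elem F (a', b))
    \<in> bilinear_relations F A B"
| add_right: "\<lbrakk>a \<in> carrier A; b \<in> carrier B; b' \<in> carrier B\<rbrakk> \<Longrightarrow>
    basis_elem F (a, b \<oplus>\<^bsub>B\<^esub> b')
      \<ominus>\<^bsub>free_pairs F A B\<^esub> (basis_elem F (a, b) \<oplus>\<^bsub>free_pairs F A B\<^esub> basis_elem F (a, b'))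
    \<in> bilinear_relations F A B"
| smult_left: "\<lbrakk>c \<in> carrier F; a \<in> carrier A; b \<in> carrier B\<rbrakk> \<Longrightarrow>
    basis_elem F (c \<odot>\<^bsub>A\<^esub> a, b) \<ominus>\<^bsub>free_pairs F A B\<^esub> (c \<odot>\<^bsub>free_pairs F A B\<^esub> basis_elem F (a, b))
    \<in> bilinear_relations F A B"
| smult_right: "\<lbrakk>c \<in> carrier F; a \<in> carrier A; b \<in> carrier B\<rbrakk> \<Longrightarrow>
    basis_elem F (a, c \<odot>\<^bsub>B\<^esub> b) \<ominus>\<^bsub>free_pairs F A B\<^esub> (c \<odot>\<^bsub>free_pairs F A B\<^esub> basis_elem F (a, b))
    \<in> bilinear_relations F A B"

definition bilinear_subspace ::
  "('f, 'r) ring_scheme \<Rightarrow> ('f, 'a, 'm) module_scheme \<Rightarrow> ('f, 'b, 'n) module_scheme \<Rightarrow>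
   ('a \<times> 'b \<Rightarrow> 'f) set" where
  "bilinear_subspace F A B = (\<lambda>N. submodule N F (free_pairs F A B)) hull bilinear_relations F A B"

definition tensor_algebra ::
  "('f, 'r) ring_scheme \<Rightarrow> ('f, 'a, 'm) module_scheme \<Rightarrow> ('f, 'b, 'n) module_scheme \<Rightarrow>
   ('f, ('a \<times> 'b \<Rightarrow> 'f) set) module" where
  "tensor_algebra F A B = quotient_algebra (free_pairs F A B) (bilinear_subspace F A B)"

definition pure_tensor ::
  "('f, 'r) ring_scheme \<Rightarrow> ('f, 'a, 'm) module_scheme \<Rightarrow> ('f, 'b, 'n) module_scheme \<Rightarrow>
   'a \<Rightarrow> 'b \<Rightarrow> ('a \<times> 'b \<Rightarrow> 'f) set" where
  "pure_tensor F A B a b = bilinear_subspace F A B +>\<^bsub>free_pairs F A B\<^esub> basis_elem F (a, b)"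

end

theory Submission
  imports Defs
begin

text \<open>
  Write \<open>t = a \<otimes> 1 + s\<close> with \<open>s = \<Sum>\<^sub>i a\<^sub>i \<otimes> b\<^sub>i\<close>, where the \<open>b\<^sub>i\<close> together with \<open>1\<close> are linearly independent in
  \<open>B\<close> (\<open>normal_form\<close>). The crucial fact is that a homomorphism \<open>\<phi>\<close> of \<open>A \<otimes> B\<close> which makes \<open>t\<close>
  central kills \<open>s\<close> (\<open>central_image_imp_zero\<close>).

  To see this, let \<open>m\<close> be an operator \<open>b \<mapsto> \<Sum>\<^sub>j x\<^sub>j b y\<^sub>j\<close> on \<open>B\<close>. Since \<open>\<phi>(t)\<close> is central,
  \<open>\<phi>((id \<otimes> m)(t)) = \<Sum>\<^sub>j \<phi>(1 \<otimes> x\<^sub>j) \<phi>(t) \<phi>(1 \<otimes> y\<^sub>j) = \<phi>(t) \<phi>(1 \<otimes> m(1))\<close> (\<open>mult_ops_central\<close>).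
  As \<open>B\<close> is central and simple, the density theorem (\<open>density\<close>) gives an \<open>m\<close> that sends the first
  \<open>b\<^sub>i\<close> to \<open>1\<close> and kills \<open>1\<close> and the other \<open>b\<^sub>i\<close>. For this \<open>m\<close> the equation says that \<open>\<phi>(a\<^sub>i \<otimes> 1) = 0\<close>
  for the first \<open>i\<close>. Dropping the first summand leaves \<open>\<phi>(t)\<close> unchanged, and repeating the argument
  yields \<open>\<phi>(s) = 0\<close>.

  The case \<open>a = 0\<close> says that \<open>s\<close> lies in the kernel of every homomorphism that makes it central, so
  \<open>s\<close> is centrally stable. In general \<open>\<phi>(t) = \<phi>(a \<otimes> 1)\<close>, so \<open>x \<mapsto> \<phi>(x \<otimes> 1)\<close> makes \<open>a\<close> central in its
  image. If \<open>a\<close> is centrally stable, then \<open>a = z + k\<close> with \<open>z\<close> in the center of \<open>A\<close> and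
  \<open>\<phi>(k \<otimes> 1) = 0\<close>, and \<open>t = z \<otimes> 1 + (k \<otimes> 1 + s)\<close> is the required decomposition of \<open>t\<close>
  (\<open>centrally_stable_decomposition\<close>).

  The rest supplies the rules of computation in \<open>A \<otimes> B\<close>: it is a unital algebra in which pure
  tensors are bilinear, multiply factor by factor, and generate.
\<close>

section \<open>Density of the multiplication operators\<close>

lemma (in unital_algebra) ring_A: "ring A"
  using mult_l_distr mult_r_distr
  by (intro ringI M.abelian_group_axioms monoid_axioms) auto

text \<open>
  For unital \<open>A\<close> these are the operators \<open>x \<mapsto> \<Sum>\<^sub>i a\<^sub>i x b\<^sub>i\<close> of the multiplication algebra of \<open>A\<close>.
  Generating them from the identity by one-sided multiplications, instead of listing the sums, makes
  composition an equality of functions on the whole type and gives an induction principle that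
  handles one multiplication at a time.
\<close>
inductive_set mult_ops :: "('a, 'm) ring_scheme \<Rightarrow> ('a \<Rightarrow> 'a) set" for A (structure) where
  ident: "(\<lambda>x. x) \<in> mult_ops A"
| left: "\<lbrakk>a \<in> carrier A; m \<in> mult_ops A\<rbrakk> \<Longrightarrow> (\<lambda>x. a \<otimes> m x) \<in> mult_ops A"
| right: "\<lbrakk>a \<in> carrier A; m \<in> mult_ops A\<rbrakk> \<Longrightarrow> (\<lambda>x. m x \<otimes> a) \<in> mult_ops A"
| sum: "\<lbrakk>m \<in> mult_ops A; m' \<in> mult_ops A\<rbrakk> \<Longrightarrow> (\<lambda>x. m x \<oplus> m' x) \<in> mult_ops A"

lemma mult_ops_comp:
  assumes "m \<in> mult_ops A" "m' \<in> mult_ops A"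
  shows "(\<lambda>x. m (m' x)) \<in> mult_ops A"
  using assms by (induction m rule: mult_ops.induct) (auto intro: mult_ops.intros)

text \<open>
  The span of a list is built up by one vector at a time because the density theorem and the
  rewriting of tensors are both inductions that separate the first vector from the rest.
\<close>
fun lin_span :: "('f, 'r) ring_scheme \<Rightarrow> ('f, 'a, 'm) module_scheme \<Rightarrow> 'a list \<Rightarrow> 'a set" where
  "lin_span F A [] = {\<zero>\<^bsub>A\<^esub>}"
| "lin_span F A (x # xs) = {c \<odot>\<^bsub>A\<^esub> x \<oplus>\<^bsub>A\<^esub> y | c y. c \<in> carrier F \<and> y \<in> lin_span F A xs}"

context unital_algebra
begin

lemma mult_ops_closed:
  assumes "m \<in> mult_ops A" "x \<in> carrier A"
  shows "m x \<in> carrier A"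
  using assms by (induction m rule: mult_ops.induct) (auto simp: mult_closed)

lemma mult_ops_add:
  assumes "m \<in> mult_ops A" "x \<in> carrier A" "y \<in> carrier A"
  shows "m (x \<oplus>\<^bsub>A\<^esub> y) = m x \<oplus>\<^bsub>A\<^esub> m y"
  using assms by (induction m rule: mult_ops.induct)
   (auto simp: mult_ops_closed mult_closed mult_l_distr mult_r_distr M.a_ac)

lemma mult_ops_smult:
  assumes "m \<in> mult_ops A" "c \<in> carrier F" "x \<in> carrier A"
  shows "m (c \<odot>\<^bsub>A\<^esub> x) = c \<odot>\<^bsub>A\<^esub> m x"
  using assms by (induction m rule: mult_ops.induct)
   (auto simp: mult_ops_closed mult_closed smult_mult_left smult_mult_right smult_r_distr)

lemma mult_ops_zero:
  assumes "m \<in> mult_ops A"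
  shows "m \<zero>\<^bsub>A\<^esub> = \<zero>\<^bsub>A\<^esub>"
  using mult_ops_smult[OF assms R.zero_closed M.zero_closed] mult_ops_closed[OF assms]
  by (simp add: smult_l_null)

lemma mult_ops_diff:
  assumes "m \<in> mult_ops A" "m' \<in> mult_ops A"
  shows "\<exists>d\<in>mult_ops A. \<forall>x\<in>carrier A. d x = m x \<ominus>\<^bsub>A\<^esub> m' x"
proof -
  interpret A: ring A by (rule ring_A)
  have "(\<lambda>x. m x \<oplus>\<^bsub>A\<^esub> (\<ominus>\<^bsub>A\<^esub> \<one>\<^bsub>A\<^esub>) \<otimes>\<^bsub>A\<^esub> m' x) \<in> mult_ops A"
    by (intro mult_ops.intros assms) simp
  then show ?thesis
    by (rule rev_bexI) (simp add: mult_ops_closed[OF assms(2)] A.l_minus M.minus_eq)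
qed

lemma lin_span_subset: "set xs \<subseteq> carrier A \<Longrightarrow> lin_span F A xs \<subseteq> carrier A"
  by (induction xs) auto

lemma lin_span_Cons_mono:
  assumes "set (x # xs) \<subseteq> carrier A" "y \<in> lin_span F A xs"
  shows "y \<in> lin_span F A (x # xs)"
proof -
  have "y \<in> carrier A" using lin_span_subset assms by auto
  then have "y = \<zero>\<^bsub>F\<^esub> \<odot>\<^bsub>A\<^esub> x \<oplus>\<^bsub>A\<^esub> y" using assms by simp
  then show ?thesis using assms(2) by auto
qed

lemma mult_ops_kill_span:
  assumes "m \<in> mult_ops A" "set xs \<subseteq> carrier A" "\<forall>x\<in>set xs. m x = \<zero>\<^bsub>A\<^esub>" "y \<in> lin_span F A xs"
  shows "m y = \<zero>\<^bsub>A\<^esub>"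
  using assms(2-4)
proof (induction xs arbitrary: y)
  case Nil
  then show ?case by (simp add: mult_ops_zero[OF assms(1)])
next
  case (Cons x xs)
  then obtain c z where "c \<in> carrier F" "z \<in> lin_span F A xs" "y = c \<odot>\<^bsub>A\<^esub> x \<oplus>\<^bsub>A\<^esub> z" by auto
  with Cons lin_span_subset[of xs] show ?case
    by (auto simp: mult_ops_add[OF assms(1)] mult_ops_smult[OF assms(1)] subset_iff)
qed

text \<open>
  The orbit of \<open>b\<close> under the multiplication operators is a two-sided ideal containing \<open>b\<close>, so in a
  simple algebra it contains the unit.
\<close>
lemma simple_mult_ops:
  assumes "simple_algebra F A" and b: "b \<in> carrier A" "b \<noteq> \<zero>\<^bsub>A\<^esub>"
  shows "\<exists>m\<in>mult_ops A. m b = \<one>\<^bsub>A\<^esub>"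
proof -
  interpret A: ring A by (rule ring_A)
  let ?I = "(\<lambda>m. m b) ` mult_ops A"
  have zero: "\<zero>\<^bsub>A\<^esub> \<in> ?I"
    using mult_ops.left[OF M.zero_closed mult_ops.ident] b by (intro image_eqI) auto
  have neg: "\<ominus>\<^bsub>A\<^esub> m b \<in> ?I" if "m \<in> mult_ops A" for m
    by (rule image_eqI[OF _ mult_ops.left[OF M.a_inv_closed[OF one_closed] that]])
      (simp add: mult_ops_closed[OF that b(1)] A.l_minus)
  have smult: "c \<odot>\<^bsub>A\<^esub> m b \<in> ?I" if "m \<in> mult_ops A" "c \<in> carrier F" for m c
    by (rule image_eqI[OF _ mult_ops.left[of "c \<odot>\<^bsub>A\<^esub> \<one>\<^bsub>A\<^esub>" _ m]])
      (auto simp: smult_mult_left that mult_ops_closed[OF that(1) b(1)])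
  have "submodule ?I F A"
    using neg smult zero mult_ops_closed[OF _ b(1)]
    by (intro submoduleI) (auto intro: image_eqI[OF refl mult_ops.sum])
  then have ideal: "algebra_ideal F A ?I"
    by (auto simp: algebra_ideal_def intro: image_eqI[OF refl mult_ops.left] image_eqI[OF refl mult_ops.right])
  have b_in: "b \<in> ?I" by (rule image_eqI[OF _ mult_ops.ident]) simp
  have "\<forall>I. algebra_ideal F A I \<longrightarrow> I = {\<zero>\<^bsub>A\<^esub>} \<or> I = carrier A"
    using assms(1) unfolding simple_algebra_def by (elim conjE)
  from this[rule_format, OF ideal] have "\<one>\<^bsub>A\<^esub> \<in> ?I"
  proof
    assume "?I = {\<zero>\<^bsub>A\<^esub>}"
    with b_in have "b \<in> {\<zero>\<^bsub>A\<^esub>}" by (simp only:)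
    with b(2) show ?thesis by simp
  next
    assume "?I = carrier A"
    then show ?thesis by (simp only: one_closed)
  qed
  then show ?thesis by (elim imageE) (rule bexI, rule sym)
qed

text \<open>
  This is the Artin--Whaples form of the density theorem for \<open>A\<close> as a simple module over its
  multiplication algebra, whose endomorphisms are the multiplications by central elements. In the
  induction step with a new vector \<open>c\<close> outside the span of \<open>xs\<close>, an operator \<open>m1\<close> is available that
  kills \<open>xs\<close> and sends \<open>c\<close> to the unit. If \<open>d = m1 b\<close> is not central, then a commutator
  \<open>x \<mapsto> u m1(x) - m1(x) u\<close> still kills \<open>xs\<close>, now kills \<open>c\<close> too, and does not kill \<open>b\<close>. If \<open>d\<close> is
  central, it is a scalar \<open>g\<close>; then \<open>b - g c\<close> lies outside the span of \<open>xs\<close>, and an operator \<open>m\<close> for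
  this vector is corrected by \<open>m1\<close> so that it kills \<open>c\<close>.
\<close>
theorem density:
  assumes csa: "central_simple_algebra F A"
    and "set xs \<subseteq> carrier A" "b \<in> carrier A" "b \<notin> lin_span F A xs"
  shows "\<exists>m\<in>mult_ops A. (\<forall>x\<in>set xs. m x = \<zero>\<^bsub>A\<^esub>) \<and> m b = \<one>\<^bsub>A\<^esub>"
  using assms(2-4)
proof (induction xs arbitrary: b)
  case Nil
  then show ?case using simple_mult_ops csa by (simp add: central_simple_algebra_def)
next
  case (Cons c xs)
  interpret A: ring A by (rule ring_A)
  have c: "c \<in> carrier A" and xs: "set xs \<subseteq> carrier A" using Cons.prems by auto
  show ?case
  proof (cases "c \<in> lin_span F A xs")
    case True
    have "b \<notin> lin_span F A xs" using Cons.prems lin_span_Cons_mono by blast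
    then obtain m where m: "m \<in> mult_ops A" "\<forall>x\<in>set xs. m x = \<zero>\<^bsub>A\<^esub>" "m b = \<one>\<^bsub>A\<^esub>"
      using Cons.IH[OF xs] Cons.prems by blast
    then show ?thesis using mult_ops_kill_span[OF m(1) xs m(2) True] by auto
  next
    case False
    then obtain m1 where m1: "m1 \<in> mult_ops A" "\<forall>x\<in>set xs. m1 x = \<zero>\<^bsub>A\<^esub>" "m1 c = \<one>\<^bsub>A\<^esub>"
      using Cons.IH[OF xs c] by blast
    define d where "d = m1 b"
    have d: "d \<in> carrier A" using mult_ops_closed m1 Cons.prems by (simp add: d_def)
    show ?thesis
    proof (cases "d \<in> center A")
      case False
      then obtain u where u: "u \<in> carrier A" "u \<otimes>\<^bsub>A\<^esub> d \<noteq> d \<otimes>\<^bsub>A\<^esub> u" using d by (force simp: center_def)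
      obtain m2 where m2: "m2 \<in> mult_ops A"
        "\<And>x. x \<in> carrier A \<Longrightarrow> m2 x = u \<otimes>\<^bsub>A\<^esub> m1 x \<ominus>\<^bsub>A\<^esub> m1 x \<otimes>\<^bsub>A\<^esub> u"
        using mult_ops_diff[OF mult_ops.left[OF u(1) m1(1)] mult_ops.right[OF u(1) m1(1)]] by blast
      have "m2 b \<noteq> \<zero>\<^bsub>A\<^esub>"
        using u d Cons.prems mult_closed
        by (simp add: m2(2) d_def[symmetric] M.minus_eq M.add.inv_solve_right')
      then obtain m3 where m3: "m3 \<in> mult_ops A" "m3 (m2 b) = \<one>\<^bsub>A\<^esub>"
        using simple_mult_ops[OF _ mult_ops_closed[OF m2(1)]] csa Cons.prems
        unfolding central_simple_algebra_def by blast
      have "m2 x = \<zero>\<^bsub>A\<^esub>" if "x \<in> set (c # xs)" for x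
        using that m1 u xs c by (auto simp: m2(2) subset_iff M.minus_eq M.r_neg)
      then have "\<forall>x\<in>set (c # xs). m3 (m2 x) = \<zero>\<^bsub>A\<^esub>"
        using mult_ops_zero[OF m3(1)] by simp
      then show ?thesis using mult_ops_comp[OF m3(1) m2(1)] m3(2) by (intro bexI) auto
    next
      case True
      then obtain g where g: "g \<in> carrier F" "d = g \<odot>\<^bsub>A\<^esub> \<one>\<^bsub>A\<^esub>"
        using csa by (auto simp: central_simple_algebra_def central_algebra_def)
      \<comment> \<open>Subtracting \<open>g c\<close> is the choice for which the correction by \<open>m1\<close> below does not change the
        value: \<open>m b - m c m1(b) = m b - g m(c) = m (b - g c)\<close>.\<close>
      define b' where "b' = b \<ominus>\<^bsub>A\<^esub> g \<odot>\<^bsub>A\<^esub> c"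
      have b': "b' \<in> carrier A" using Cons.prems c g by (simp add: b'_def)
      have b_eq: "b = g \<odot>\<^bsub>A\<^esub> c \<oplus>\<^bsub>A\<^esub> b'"
        using Cons.prems(2) c g(1) by (simp add: b'_def M.minus_eq M.a_lcomm M.r_neg)
      have "b' \<notin> lin_span F A xs"
        using Cons.prems(3) b_eq g(1) by auto
      then obtain m where m: "m \<in> mult_ops A" "\<forall>x\<in>set xs. m x = \<zero>\<^bsub>A\<^esub>" "m b' = \<one>\<^bsub>A\<^esub>"
        using Cons.IH[OF xs b'] by blast
      have mc: "m c \<in> carrier A" using mult_ops_closed m c by blast
      obtain m2 where m2: "m2 \<in> mult_ops A"
        "\<And>x. x \<in> carrier A \<Longrightarrow> m2 x = m x \<ominus>\<^bsub>A\<^esub> m c \<otimes>\<^bsub>A\<^esub> m1 x"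
        using mult_ops_diff[OF m(1) mult_ops.left[OF mc m1(1)]] by blast
      have "m2 x = \<zero>\<^bsub>A\<^esub>" if "x \<in> set (c # xs)" for x
        using that m m1 mc xs c by (auto simp: m2(2) subset_iff M.minus_eq M.r_neg)
      moreover have "m b = g \<odot>\<^bsub>A\<^esub> m c \<oplus>\<^bsub>A\<^esub> \<one>\<^bsub>A\<^esub>"
        using m c g b' by (simp add: b_eq mult_ops_add mult_ops_smult)
      then have "m2 b = \<one>\<^bsub>A\<^esub>"
        using Cons.prems(2) mc g
        by (simp add: m2(2) d_def[symmetric] smult_mult_right M.minus_eq M.a_assoc M.a_comm[of "\<one>\<^bsub>A\<^esub>"] M.r_neg2)
      ultimately show ?thesis by (intro bexI[OF _ m2(1)] conjI ballI)
    qed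
  qed
qed

end

section \<open>Semigroup algebras\<close>

locale monoid_algebra = F?: field F + G: monoid G for F (structure) and G (structure)
begin

abbreviation S :: "('a, 'c \<Rightarrow> 'a) module" where "S \<equiv> semigroup_algebra F G"

lemma S_carrierD:
  assumes "f \<in> carrier S"
  shows "f p \<in> carrier F" "finite {p. f p \<noteq> \<zero>}" "{p. f p \<noteq> \<zero>} \<subseteq> carrier G"
  using assms by (auto simp: semigroup_algebra_def)

lemma S_carrierI:
  assumes "\<And>p. f p \<in> carrier F" "finite X" "{p. f p \<noteq> \<zero>} \<subseteq> X" "X \<subseteq> carrier G"
  shows "f \<in> carrier S"
  using assms finite_subset[OF assms(3)] by (auto simp: semigroup_algebra_def)

lemma S_simps:
  "(f \<oplus>\<^bsub>S\<^esub> g) = (\<lambda>p. f p \<oplus> g p)" "\<zero>\<^bsub>S\<^esub> = (\<lambda>p. \<zero>)" "(c \<odot>\<^bsub>S\<^esub> f) = (\<lambda>p. c \<otimes> f p)"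
  "\<one>\<^bsub>S\<^esub> = basis_elem F \<one>\<^bsub>G\<^esub>"
  by (auto simp: semigroup_algebra_def basis_elem_def)

lemma basis_closed [simp, intro]: "p \<in> carrier G \<Longrightarrow> basis_elem F p \<in> carrier S"
  by (rule S_carrierI[of _ "{p}"]) (auto simp: basis_elem_def)

lemma S_add_closed: "f \<in> carrier S \<Longrightarrow> g \<in> carrier S \<Longrightarrow> f \<oplus>\<^bsub>S\<^esub> g \<in> carrier S"
  using S_carrierD[of f] S_carrierD[of g]
  by (intro S_carrierI[of _ "{p. f p \<noteq> \<zero>} \<union> {p. g p \<noteq> \<zero>}"]) (auto simp: S_simps)

lemma S_smult_closed: "f \<in> carrier S \<Longrightarrow> c \<in> carrier F \<Longrightarrow> c \<odot>\<^bsub>S\<^esub> f \<in> carrier S"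
  using S_carrierD[of f] by (intro S_carrierI[of _ "{p. f p \<noteq> \<zero>}"]) (auto simp: S_simps)

lemma S_zero_closed: "\<zero>\<^bsub>S\<^esub> \<in> carrier S"
  by (intro S_carrierI[of _ "{}"]) (auto simp: S_simps)

lemma S_module: "module F S"
proof (rule moduleI)
  show "abelian_group S"
  proof (rule abelian_groupI)
    fix f assume f: "f \<in> carrier S"
    have "(\<ominus> \<one>) \<odot>\<^bsub>S\<^esub> f \<oplus>\<^bsub>S\<^esub> f = \<zero>\<^bsub>S\<^esub>"
      using S_carrierD[OF f] by (auto simp: S_simps F.l_minus F.l_neg)
    then show "\<exists>g\<in>carrier S. g \<oplus>\<^bsub>S\<^esub> f = \<zero>\<^bsub>S\<^esub>" using S_smult_closed[OF f] by blast
  qed (auto simp: S_add_closed S_zero_closed, auto simp: S_simps S_carrierD(1) F.a_ac)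
qed (auto simp: S_smult_closed is_cring,
    auto simp: S_simps S_carrierD(1) F.l_distr F.r_distr F.m_ac)

text \<open>
  Multiplying out over arbitrary finite sets containing the supports lets the sums for several
  functions range over a common index set, which the distributive laws need.
\<close>
lemma S_mult:
  assumes "f \<in> carrier S" "g \<in> carrier S"
    and "finite X" "{p. f p \<noteq> \<zero>} \<subseteq> X" "finite Y" "{p. g p \<noteq> \<zero>} \<subseteq> Y"
  shows "(f \<otimes>\<^bsub>S\<^esub> g) p = (\<Oplus>q\<in>X. \<Oplus>r\<in>Y. if q \<otimes>\<^bsub>G\<^esub> r = p then f q \<otimes> g r else \<zero>)"
proof -
  note fg = S_carrierD[OF assms(1)] S_carrierD[OF assms(2)]
  have "(\<Oplus>r\<in>{r. g r \<noteq> \<zero>}. if q \<otimes>\<^bsub>G\<^esub> r = p then f q \<otimes> g r else \<zero>) =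
    (\<Oplus>r\<in>Y. if q \<otimes>\<^bsub>G\<^esub> r = p then f q \<otimes> g r else \<zero>)" for q
    using assms fg by (intro F.add.finprod_mono_neutral_cong_left) auto
  moreover have "(\<Oplus>q\<in>{q. f q \<noteq> \<zero>}. \<Oplus>r\<in>Y. if q \<otimes>\<^bsub>G\<^esub> r = p then f q \<otimes> g r else \<zero>) =
    (\<Oplus>q\<in>X. \<Oplus>r\<in>Y. if q \<otimes>\<^bsub>G\<^esub> r = p then f q \<otimes> g r else \<zero>)"
  proof (rule F.add.finprod_mono_neutral_cong_left)
    show "(\<Oplus>r\<in>Y. if q \<otimes>\<^bsub>G\<^esub> r = p then f q \<otimes> g r else \<zero>) = \<zero>" if "q \<in> X - {q. f q \<noteq> \<zero>}" for q
      using that fg by (intro F.add.finprod_one_eqI) auto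
  qed (use assms fg in auto)
  ultimately show ?thesis by (simp add: semigroup_algebra_def)
qed

lemma S_mult_closed:
  assumes f: "f \<in> carrier S" and g: "g \<in> carrier S"
  shows "f \<otimes>\<^bsub>S\<^esub> g \<in> carrier S"
proof -
  note fg = S_carrierD[OF f] S_carrierD[OF g]
  let ?X = "{p. f p \<noteq> \<zero>}" and ?Y = "{p. g p \<noteq> \<zero>}"
  note eq = S_mult[OF f g fg(2) subset_refl fg(5) subset_refl]
  show ?thesis
  proof (rule S_carrierI)
    show "(f \<otimes>\<^bsub>S\<^esub> g) p \<in> carrier F" for p
      unfolding eq using fg by (intro F.finsum_closed) auto
    show "{p. (f \<otimes>\<^bsub>S\<^esub> g) p \<noteq> \<zero>} \<subseteq> (\<lambda>(q, r). q \<otimes>\<^bsub>G\<^esub> r) ` (?X \<times> ?Y)"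
    proof (rule subsetI, rule ccontr)
      fix p assume p: "p \<in> {p. (f \<otimes>\<^bsub>S\<^esub> g) p \<noteq> \<zero>}" "p \<notin> (\<lambda>(q, r). q \<otimes>\<^bsub>G\<^esub> r) ` (?X \<times> ?Y)"
      have "(f \<otimes>\<^bsub>S\<^esub> g) p = \<zero>"
        unfolding eq using p(2) fg by (intro F.add.finprod_one_eqI) auto
      with p(1) show False by simp
    qed
  qed (use fg in auto)
qed

lemma S_l_distr:
  assumes f: "f \<in> carrier S" and f': "f' \<in> carrier S" and g: "g \<in> carrier S"
  shows "(f \<oplus>\<^bsub>S\<^esub> f') \<otimes>\<^bsub>S\<^esub> g = f \<otimes>\<^bsub>S\<^esub> g \<oplus>\<^bsub>S\<^esub> f' \<otimes>\<^bsub>S\<^esub> g"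
proof
  fix p
  note c = S_carrierD[OF f] S_carrierD[OF f'] S_carrierD[OF g]
  let ?X = "{p. f p \<noteq> \<zero>} \<union> {p. f' p \<noteq> \<zero>}" and ?Y = "{p. g p \<noteq> \<zero>}"
  have X: "finite ?X" "{p. (f \<oplus>\<^bsub>S\<^esub> f') p \<noteq> \<zero>} \<subseteq> ?X"
    "{p. f p \<noteq> \<zero>} \<subseteq> ?X" "{p. f' p \<noteq> \<zero>} \<subseteq> ?X"
    using c by (auto simp: S_simps)
  show "((f \<oplus>\<^bsub>S\<^esub> f') \<otimes>\<^bsub>S\<^esub> g) p = (f \<otimes>\<^bsub>S\<^esub> g \<oplus>\<^bsub>S\<^esub> f' \<otimes>\<^bsub>S\<^esub> g) p"
    unfolding S_simps(1)[of "f \<otimes>\<^bsub>S\<^esub> g"] S_mult[OF f g X(1,3) c(8) subset_refl]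
      S_mult[OF f' g X(1,4) c(8) subset_refl]
      S_mult[OF S_add_closed[OF f f'] g X(1,2) c(8) subset_refl]
    using c by (simp add: F.finsum_addf[symmetric] Pi_def S_simps if_distrib F.l_distr cong: if_cong)
qed

lemma S_r_distr:
  assumes f: "f \<in> carrier S" and f': "f' \<in> carrier S" and g: "g \<in> carrier S"
  shows "g \<otimes>\<^bsub>S\<^esub> (f \<oplus>\<^bsub>S\<^esub> f') = g \<otimes>\<^bsub>S\<^esub> f \<oplus>\<^bsub>S\<^esub> g \<otimes>\<^bsub>S\<^esub> f'"
proof
  fix p
  note c = S_carrierD[OF f] S_carrierD[OF f'] S_carrierD[OF g]
  let ?X = "{p. f p \<noteq> \<zero>} \<union> {p. f' p \<noteq> \<zero>}" and ?Y = "{p. g p \<noteq> \<zero>}"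
  have X: "finite ?X" "{p. (f \<oplus>\<^bsub>S\<^esub> f') p \<noteq> \<zero>} \<subseteq> ?X"
    "{p. f p \<noteq> \<zero>} \<subseteq> ?X" "{p. f' p \<noteq> \<zero>} \<subseteq> ?X"
    using c by (auto simp: S_simps)
  show "(g \<otimes>\<^bsub>S\<^esub> (f \<oplus>\<^bsub>S\<^esub> f')) p = (g \<otimes>\<^bsub>S\<^esub> f \<oplus>\<^bsub>S\<^esub> g \<otimes>\<^bsub>S\<^esub> f') p"
    unfolding S_simps(1)[of "g \<otimes>\<^bsub>S\<^esub> f"] S_mult[OF g f c(8) subset_refl X(1,3)]
      S_mult[OF g f' c(8) subset_refl X(1,4)]
      S_mult[OF g S_add_closed[OF f f'] c(8) subset_refl X(1,2)]
    using c by (simp add: F.finsum_addf[symmetric] Pi_def S_simps if_distrib F.r_distr cong: if_cong)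
qed

lemma S_smult_mult:
  assumes f: "f \<in> carrier S" and g: "g \<in> carrier S" and a: "a \<in> carrier F"
  shows "(a \<odot>\<^bsub>S\<^esub> f) \<otimes>\<^bsub>S\<^esub> g = a \<odot>\<^bsub>S\<^esub> (f \<otimes>\<^bsub>S\<^esub> g)"
    and "f \<otimes>\<^bsub>S\<^esub> (a \<odot>\<^bsub>S\<^esub> g) = a \<odot>\<^bsub>S\<^esub> (f \<otimes>\<^bsub>S\<^esub> g)"
proof -
  note c = S_carrierD[OF f] S_carrierD[OF g]
  let ?X = "{p. f p \<noteq> \<zero>}" and ?Y = "{p. g p \<noteq> \<zero>}"
  have sub: "{p. (a \<odot>\<^bsub>S\<^esub> f) p \<noteq> \<zero>} \<subseteq> ?X" "{p. (a \<odot>\<^bsub>S\<^esub> g) p \<noteq> \<zero>} \<subseteq> ?Y"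
    using a by (auto simp: S_simps)
  have *: "a \<otimes> (f \<otimes>\<^bsub>S\<^esub> g) p = (\<Oplus>q\<in>?X. \<Oplus>r\<in>?Y. if q \<otimes>\<^bsub>G\<^esub> r = p then a \<otimes> (f q \<otimes> g r) else \<zero>)" for p
    unfolding S_mult[OF f g c(2) subset_refl c(5) subset_refl] using c a
    by (simp add: F.finsum_rdistr Pi_def if_distrib cong: if_cong)
  show "(a \<odot>\<^bsub>S\<^esub> f) \<otimes>\<^bsub>S\<^esub> g = a \<odot>\<^bsub>S\<^esub> (f \<otimes>\<^bsub>S\<^esub> g)"
    unfolding S_simps(3)[of a "f \<otimes>\<^bsub>S\<^esub> g"] * using c a
    by (intro ext, subst S_mult[OF S_smult_closed[OF f a] g c(2) sub(1) c(5) subset_refl])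
      (auto intro!: F.finsum_cong' F.finsum_closed simp: S_simps F.m_assoc)
  show "f \<otimes>\<^bsub>S\<^esub> (a \<odot>\<^bsub>S\<^esub> g) = a \<odot>\<^bsub>S\<^esub> (f \<otimes>\<^bsub>S\<^esub> g)"
    unfolding S_simps(3)[of a "f \<otimes>\<^bsub>S\<^esub> g"] * using c a
    by (intro ext, subst S_mult[OF f S_smult_closed[OF g a] c(2) subset_refl c(5) sub(2)])
      (auto intro!: F.finsum_cong' F.finsum_closed simp: S_simps F.m_lcomm)
qed

lemma basis_mult:
  assumes "p \<in> carrier G" "q \<in> carrier G"
  shows "basis_elem F p \<otimes>\<^bsub>S\<^esub> basis_elem F q = basis_elem F (p \<otimes>\<^bsub>G\<^esub> q)"
proof
  fix r
  show "(basis_elem F p \<otimes>\<^bsub>S\<^esub> basis_elem F q) r = basis_elem F (p \<otimes>\<^bsub>G\<^esub> q) r"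
    by (subst S_mult[OF basis_closed[OF assms(1)] basis_closed[OF assms(2)], of "{p}" "{q}"])
      (use assms in \<open>auto simp: basis_elem_def\<close>)
qed

text \<open>
  Peeling off one point of the support at a time reduces bilinear statements to basis elements.
\<close>
lemma S_induct [consumes 1, case_names zero add]:
  assumes "f \<in> carrier S" and zero: "P \<zero>\<^bsub>S\<^esub>"
    and add: "\<And>c p f. \<lbrakk>c \<in> carrier F; p \<in> carrier G; f \<in> carrier S; P f\<rbrakk> \<Longrightarrow>
      P (c \<odot>\<^bsub>S\<^esub> basis_elem F p \<oplus>\<^bsub>S\<^esub> f)"
  shows "P f"
proof -
  have "\<forall>f\<in>carrier S. {p. f p \<noteq> \<zero>} \<subseteq> X \<longrightarrow> P f" if "finite X" "X \<subseteq> carrier G" for X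
    using that
  proof (induction X)
    case empty
    have "f = \<zero>\<^bsub>S\<^esub>" if "{p. f p \<noteq> \<zero>} \<subseteq> {}" for f using that by (auto simp: S_simps)
    then show ?case using zero by blast
  next
    case (insert p X)
    show ?case
    proof (intro ballI impI)
      fix f assume f: "f \<in> carrier S" "{p. f p \<noteq> \<zero>} \<subseteq> insert p X"
      have g: "f(p := \<zero>) \<in> carrier S"
        using S_carrierD[OF f(1)] f(2) insert.prems insert.hyps by (intro S_carrierI[of _ X]) auto
      have "{q. (f(p := \<zero>)) q \<noteq> \<zero>} \<subseteq> X" using f(2) by auto
      then have "P (f(p := \<zero>))" using insert g by blast
      moreover have "f = f p \<odot>\<^bsub>S\<^esub> basis_elem F p \<oplus>\<^bsub>S\<^esub> f(p := \<zero>)"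
        using S_carrierD[OF f(1)] by (auto simp: S_simps basis_elem_def)
      ultimately show "P f"
        using add[of "f p" p "f(p := \<zero>)"] g insert.prems S_carrierD[OF f(1)] by simp
    qed
  qed
  then show ?thesis using S_carrierD[OF assms(1)] assms(1) by blast
qed

text \<open>
  Associativity and the unit laws are multilinear and hold on basis elements, where they are the
  monoid laws of \<open>G\<close>; the arguments are freed from being basis elements one after the other.
\<close>
lemma S_algebra: "unital_algebra F S"
proof -
  interpret S: module F S by (rule S_module)
  note simps = S_mult_closed S_l_distr S_r_distr S_smult_mult
  have null: "\<zero>\<^bsub>S\<^esub> \<otimes>\<^bsub>S\<^esub> f = \<zero>\<^bsub>S\<^esub>" "f \<otimes>\<^bsub>S\<^esub> \<zero>\<^bsub>S\<^esub> = \<zero>\<^bsub>S\<^esub>" if "f \<in> carrier S" for f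
    using S_smult_mult[OF S.zero_closed that F.zero_closed]
      S_smult_mult[OF that S.zero_closed F.zero_closed] that
    by (simp_all add: S_mult_closed)
  have one: "\<one>\<^bsub>S\<^esub> \<otimes>\<^bsub>S\<^esub> f = f" "f \<otimes>\<^bsub>S\<^esub> \<one>\<^bsub>S\<^esub> = f" if "f \<in> carrier S" for f
    using that by (induction rule: S_induct) (simp_all add: S_simps(4) simps null basis_mult)
  have a1: "(basis_elem F p \<otimes>\<^bsub>S\<^esub> basis_elem F q) \<otimes>\<^bsub>S\<^esub> h = basis_elem F p \<otimes>\<^bsub>S\<^esub> (basis_elem F q \<otimes>\<^bsub>S\<^esub> h)"
    if "p \<in> carrier G" "q \<in> carrier G" "h \<in> carrier S" for p q h
    using that(3,1,2) by (induction rule: S_induct) (simp_all add: simps null basis_mult G.m_assoc)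
  have a2: "(basis_elem F p \<otimes>\<^bsub>S\<^esub> g) \<otimes>\<^bsub>S\<^esub> h = basis_elem F p \<otimes>\<^bsub>S\<^esub> (g \<otimes>\<^bsub>S\<^esub> h)"
    if "p \<in> carrier G" "g \<in> carrier S" "h \<in> carrier S" for p g h
    using that(2,1,3) by (induction rule: S_induct) (simp_all add: simps null a1)
  have assoc: "(f \<otimes>\<^bsub>S\<^esub> g) \<otimes>\<^bsub>S\<^esub> h = f \<otimes>\<^bsub>S\<^esub> (g \<otimes>\<^bsub>S\<^esub> h)"
    if "f \<in> carrier S" "g \<in> carrier S" "h \<in> carrier S" for f g h
    using that by (induction rule: S_induct) (simp_all add: simps null a2)
  show ?thesis
    by (intro unital_algebra.intro assoc_algebra.intro assoc_algebra_axioms.intro S_module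
        F.field_axioms monoidI)
      (auto simp: simps assoc one, simp add: S_simps(4))
qed

end

section \<open>Quotient algebras and tensor products\<close>

context unital_algebra
begin

lemma algebra_ideal_imp_ideal:
  assumes "algebra_ideal F A N"
  shows "ideal N A"
proof -
  have sub: "submodule N F A" using assms by (simp add: algebra_ideal_def)
  interpret A: ring A by (rule ring_A)
  show ?thesis
    using assms submoduleE[OF sub] sub
    by (intro idealI A.ring_axioms) (auto simp: algebra_ideal_def submodule_def)
qed

lemma quotient_algebra_simps:
  "carrier (quotient_algebra A N) = a_rcosets\<^bsub>A\<^esub> N"
  "\<zero>\<^bsub>quotient_algebra A N\<^esub> = N"
  "\<one>\<^bsub>quotient_algebra A N\<^esub> = N +>\<^bsub>A\<^esub> \<one>\<^bsub>A\<^esub>"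
  "X \<oplus>\<^bsub>quotient_algebra A N\<^esub> Y = X <+>\<^bsub>A\<^esub> Y"
  "X \<otimes>\<^bsub>quotient_algebra A N\<^esub> Y = rcoset_mult A N X Y"
  "c \<odot>\<^bsub>quotient_algebra A N\<^esub> X = (\<Union>x\<in>X. N +>\<^bsub>A\<^esub> (c \<odot>\<^bsub>A\<^esub> x))"
  by (simp_all add: quotient_algebra_def ring.defs module.defs FactRing_def)

lemma quotient_algebra_coset_simps:
  assumes N: "algebra_ideal F A N" and x: "x \<in> carrier A"
  shows "N +>\<^bsub>A\<^esub> x \<in> carrier (quotient_algebra A N)"
    and "y \<in> carrier A \<Longrightarrow>
      (N +>\<^bsub>A\<^esub> x) \<oplus>\<^bsub>quotient_algebra A N\<^esub> (N +>\<^bsub>A\<^esub> y) = N +>\<^bsub>A\<^esub> (x \<oplus>\<^bsub>A\<^esub> y)"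
    and "y \<in> carrier A \<Longrightarrow>
      (N +>\<^bsub>A\<^esub> x) \<otimes>\<^bsub>quotient_algebra A N\<^esub> (N +>\<^bsub>A\<^esub> y) = N +>\<^bsub>A\<^esub> (x \<otimes>\<^bsub>A\<^esub> y)"
    and "c \<in> carrier F \<Longrightarrow>
      c \<odot>\<^bsub>quotient_algebra A N\<^esub> (N +>\<^bsub>A\<^esub> x) = N +>\<^bsub>A\<^esub> (c \<odot>\<^bsub>A\<^esub> x)"
    and "N +>\<^bsub>A\<^esub> \<zero>\<^bsub>A\<^esub> = N"
proof -
  interpret N: ideal N A by (rule algebra_ideal_imp_ideal[OF N])
  show "N +>\<^bsub>A\<^esub> x \<in> carrier (quotient_algebra A N)"
    by (simp add: quotient_algebra_simps M.a_rcosetsI N.a_subset x)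
  show "(N +>\<^bsub>A\<^esub> x) \<oplus>\<^bsub>quotient_algebra A N\<^esub> (N +>\<^bsub>A\<^esub> y) = N +>\<^bsub>A\<^esub> (x \<oplus>\<^bsub>A\<^esub> y)" if "y \<in> carrier A"
    by (simp add: quotient_algebra_simps N.a_rcos_sum x that)
  show "(N +>\<^bsub>A\<^esub> x) \<otimes>\<^bsub>quotient_algebra A N\<^esub> (N +>\<^bsub>A\<^esub> y) = N +>\<^bsub>A\<^esub> (x \<otimes>\<^bsub>A\<^esub> y)" if "y \<in> carrier A"
    by (simp add: quotient_algebra_simps N.rcoset_mult_add x that)
  show "N +>\<^bsub>A\<^esub> \<zero>\<^bsub>A\<^esub> = N" by (simp add: N.a_subset)
  show "c \<odot>\<^bsub>quotient_algebra A N\<^esub> (N +>\<^bsub>A\<^esub> x) = N +>\<^bsub>A\<^esub> (c \<odot>\<^bsub>A\<^esub> x)" if c: "c \<in> carrier F"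
  proof -
    have "N +>\<^bsub>A\<^esub> (c \<odot>\<^bsub>A\<^esub> x') = N +>\<^bsub>A\<^esub> (c \<odot>\<^bsub>A\<^esub> x)" if x': "x' \<in> N +>\<^bsub>A\<^esub> x" for x'
    proof -
      obtain n where n: "n \<in> N" "x' = n \<oplus>\<^bsub>A\<^esub> x" using x' by (auto simp: a_r_coset_def r_coset_def)
      have nc: "n \<in> carrier A" using n N.a_subset by blast
      have "c \<odot>\<^bsub>A\<^esub> n \<in> N" using N c n by (auto simp: algebra_ideal_def submodule_def submodule_axioms_def)
      moreover have "c \<odot>\<^bsub>A\<^esub> x' = c \<odot>\<^bsub>A\<^esub> n \<oplus>\<^bsub>A\<^esub> c \<odot>\<^bsub>A\<^esub> x" using n nc x c by (simp add: smult_r_distr)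
      ultimately have "c \<odot>\<^bsub>A\<^esub> x' \<ominus>\<^bsub>A\<^esub> c \<odot>\<^bsub>A\<^esub> x \<in> N"
        using x c nc by (simp add: M.minus_eq M.a_assoc M.r_neg)
      then show ?thesis
        using N.quotient_eq_iff_same_a_r_cos[OF N.is_ideal, of "c \<odot>\<^bsub>A\<^esub> x'" "c \<odot>\<^bsub>A\<^esub> x"] n nc x c by simp
    qed
    moreover have "x \<in> N +>\<^bsub>A\<^esub> x" by (rule N.a_rcos_self[OF x])
    ultimately show ?thesis unfolding quotient_algebra_simps by blast
  qed
qed

lemma quotient_algebra_cases:
  assumes "X \<in> carrier (quotient_algebra A N)"
  obtains x where "x \<in> carrier A" "X = N +>\<^bsub>A\<^esub> x"
  using assms unfolding quotient_algebra_simps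
  by (auto simp: A_RCOSETS_def RCOSETS_def a_r_coset_def)

lemma quotient_algebra_unital:
  assumes N: "algebra_ideal F A N"
  shows "unital_algebra F (quotient_algebra A N)"
proof -
  let ?Q = "quotient_algebra A N"
  interpret N: ideal N A by (rule algebra_ideal_imp_ideal[OF N])
  note simps = quotient_algebra_coset_simps[OF N]
  have zero: "\<zero>\<^bsub>?Q\<^esub> = N +>\<^bsub>A\<^esub> \<zero>\<^bsub>A\<^esub>" and one: "\<one>\<^bsub>?Q\<^esub> = N +>\<^bsub>A\<^esub> \<one>\<^bsub>A\<^esub>"
    by (simp_all add: quotient_algebra_simps simps(5)[OF M.zero_closed])
  note cases = quotient_algebra_cases
  have "abelian_group ?Q"
  proof (rule abelian_groupI)
    fix X assume "X \<in> carrier ?Q"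
    then obtain x where x: "x \<in> carrier A" "X = N +>\<^bsub>A\<^esub> x" by (rule cases)
    then show "\<exists>Y\<in>carrier ?Q. Y \<oplus>\<^bsub>?Q\<^esub> X = \<zero>\<^bsub>?Q\<^esub>"
      by (intro bexI[of _ "N +>\<^bsub>A\<^esub> (\<ominus>\<^bsub>A\<^esub> x)"]) (simp_all add: simps(1-4) zero M.l_neg)
  qed (auto elim!: cases simp: simps(1-4) zero M.a_ac)
  then have "module F ?Q"
    by (intro moduleI)
      (auto elim!: cases simp: simps(1-4) zero smult_l_distr smult_r_distr smult_assoc1 R.is_cring)
  moreover have "Group.monoid ?Q"
    by (rule monoidI) (auto elim!: cases simp: simps(1-4) one m_assoc)
  ultimately show ?thesis
    by (intro unital_algebra.intro assoc_algebra.intro assoc_algebra_axioms.intro field_axioms)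
      (auto elim!: cases simp: simps(1-4) mult_closed mult_assoc mult_l_distr mult_r_distr
        smult_mult_left smult_mult_right)
qed

end

locale tensor_product = A: unital_algebra F A + B: unital_algebra F B
  for F :: "('f, 'r) ring_scheme" (structure) and A :: "('f, 'a, 'm) module_scheme"
    and B :: "('f, 'b, 'n) module_scheme"
begin

abbreviation P where "P \<equiv> free_pairs F A B"
abbreviation N where "N \<equiv> bilinear_subspace F A B"
abbreviation T where "T \<equiv> tensor_algebra F A B"
abbreviation tens (infixl "\<boxtimes>" 75) where "a \<boxtimes> b \<equiv> pure_tensor F A B a b"

interpretation MA: monoid_algebra F "A \<times>\<times> B"
  by (intro monoid_algebra.intro A.field_axioms DirProd_monoid A.monoid_axioms B.monoid_axioms)

lemma P_eq: "P = semigroup_algebra F (A \<times>\<times> B)" by (simp add: free_pairs_def)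

lemma P_algebra: "unital_algebra F P"
  unfolding P_eq by (rule MA.S_algebra)

interpretation P: unital_algebra F P by (rule P_algebra)
interpretation PR: ring P by (rule P.ring_A)

lemma basis_P [simp, intro]: "a \<in> carrier A \<Longrightarrow> b \<in> carrier B \<Longrightarrow> basis_elem F (a, b) \<in> carrier P"
  unfolding P_eq by (rule MA.basis_closed) simp

lemma basis_mult_P:
  assumes "a \<in> carrier A" "b \<in> carrier B" "a' \<in> carrier A" "b' \<in> carrier B"
  shows "basis_elem F (a, b) \<otimes>\<^bsub>P\<^esub> basis_elem F (a', b') = basis_elem F (a \<otimes>\<^bsub>A\<^esub> a', b \<otimes>\<^bsub>B\<^esub> b')"
  unfolding P_eq using MA.basis_mult[of "(a, b)" "(a', b')"] assms by simp

lemma relations_closed: "bilinear_relations F A B \<subseteq> carrier P"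
  by (auto elim!: bilinear_relations.cases)

lemma N_submodule: "submodule N F P"
proof -
  have carr: "submodule (carrier P) F P" by (rule P.carrier_is_submodule)
  have N: "N = \<Inter>{M. submodule M F P \<and> bilinear_relations F A B \<subseteq> M}"
    by (simp add: bilinear_subspace_def hull_def)
  have zero: "\<zero>\<^bsub>P\<^esub> \<in> M" if "submodule M F P" for M
    using subgroup.one_closed[OF submodule.axioms(1)[OF that]] by simp
  show ?thesis
  proof (rule P.submoduleI)
    show "N \<subseteq> carrier P" unfolding N using carr relations_closed by blast
  qed (auto simp: N zero P.submoduleE(3-5))
qed

lemma relations_N: "bilinear_relations F A B \<subseteq> N"
  unfolding bilinear_subspace_def by (rule hull_subset)

text \<open>
  Multiplying a bilinearity relation by a pair gives a bilinearity relation of the same kind, because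
  left and right multiplications in \<open>A\<close> and \<open>B\<close> are linear. This is what makes the span of the
  relations an ideal.
\<close>
lemma relations_absorb:
  assumes r: "r \<in> bilinear_relations F A B" and ab: "a \<in> carrier A" "b \<in> carrier B"
  shows "basis_elem F (a, b) \<otimes>\<^bsub>P\<^esub> r \<in> bilinear_relations F A B"
    and "r \<otimes>\<^bsub>P\<^esub> basis_elem F (a, b) \<in> bilinear_relations F A B"
proof -
  note simps = P.M.minus_eq PR.r_distr PR.l_distr PR.r_minus PR.l_minus basis_mult_P
    P.smult_mult_left P.smult_mult_right A.mult_r_distr B.mult_r_distr A.mult_l_distr B.mult_l_distr
    A.smult_mult_left A.smult_mult_right B.smult_mult_left B.smult_mult_right
  note rels = bilinear_relations.intros[where F = F and A = A and B = B, unfolded P.M.minus_eq]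
  show "basis_elem F (a, b) \<otimes>\<^bsub>P\<^esub> r \<in> bilinear_relations F A B"
    using r by cases (use ab in \<open>simp_all add: simps rels\<close>)
  show "r \<otimes>\<^bsub>P\<^esub> basis_elem F (a, b) \<in> bilinear_relations F A B"
    using r by cases (use ab in \<open>simp_all add: simps rels\<close>)
qed

text \<open>
  The elements of the span that pairs multiply back into the span form a subspace containing the
  relations, hence they are the whole span. Linearity extends this from pairs to all multipliers.
\<close>
lemma N_ideal: "algebra_ideal F P N"
proof -
  note N = P.submoduleE[OF N_submodule]
  have Nc: "x \<in> carrier P" if "x \<in> N" for x using N(1) that by blast
  let ?J = "{x \<in> N. \<forall>a\<in>carrier A. \<forall>b\<in>carrier B.
    basis_elem F (a, b) \<otimes>\<^bsub>P\<^esub> x \<in> N \<and> x \<otimes>\<^bsub>P\<^esub> basis_elem F (a, b) \<in> N}"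
  have zeroN: "\<zero>\<^bsub>P\<^esub> \<in> N" using subgroup.one_closed[OF submodule.axioms(1)[OF N_submodule]] by simp
  have "submodule ?J F P"
    by (intro P.submoduleI)
      (auto simp: Nc zeroN N(3-5) PR.r_distr PR.l_distr PR.r_minus PR.l_minus
        P.smult_mult_left P.smult_mult_right)
  moreover have "bilinear_relations F A B \<subseteq> ?J"
    using relations_N relations_absorb by auto
  ultimately have J: "N \<subseteq> ?J"
    by (subst bilinear_subspace_def) (rule hull_minimal)
  have "f \<otimes>\<^bsub>P\<^esub> x \<in> N \<and> x \<otimes>\<^bsub>P\<^esub> f \<in> N" if "x \<in> N" "f \<in> carrier P" for x f
    using that(2) unfolding P_eq
  proof (induction rule: MA.S_induct)
    case zero
    then show ?case using zeroN Nc that(1) by (simp add: P_eq[symmetric])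
  next
    case (add c p f)
    obtain a b where p: "p = (a, b)" "a \<in> carrier A" "b \<in> carrier B" using add by auto
    have "basis_elem F (a, b) \<otimes>\<^bsub>P\<^esub> x \<in> N" "x \<otimes>\<^bsub>P\<^esub> basis_elem F (a, b) \<in> N" using J p that(1) by auto
    then show ?case using add p Nc[OF that(1)] unfolding P_eq[symmetric]
      by (simp add: PR.r_distr PR.l_distr P.smult_mult_left P.smult_mult_right N(4,5))
  qed
  then show ?thesis using N_submodule by (simp add: algebra_ideal_def)
qed

lemma T_eq: "T = quotient_algebra P N" by (simp add: tensor_algebra_def)

lemma T_algebra: "unital_algebra F T"
  unfolding T_eq by (rule P.quotient_algebra_unital[OF N_ideal])

lemmas T_simps = P.quotient_algebra_coset_simps[OF N_ideal, folded T_eq]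

lemma coset_eqI:
  assumes "x \<ominus>\<^bsub>P\<^esub> y \<in> bilinear_relations F A B" "x \<in> carrier P" "y \<in> carrier P"
  shows "N +>\<^bsub>P\<^esub> x = N +>\<^bsub>P\<^esub> y"
  using PR.quotient_eq_iff_same_a_r_cos[OF P.algebra_ideal_imp_ideal[OF N_ideal] assms(2,3)]
    assms(1) relations_N by blast

lemma tens_closed [simp, intro]: "a \<in> carrier A \<Longrightarrow> b \<in> carrier B \<Longrightarrow> a \<boxtimes> b \<in> carrier T"
  by (simp add: pure_tensor_def T_simps(1))

lemma tens_add_left:
  assumes "a \<in> carrier A" "a' \<in> carrier A" "b \<in> carrier B"
  shows "(a \<oplus>\<^bsub>A\<^esub> a') \<boxtimes> b = a \<boxtimes> b \<oplus>\<^bsub>T\<^esub> a' \<boxtimes> b"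
  using coset_eqI[OF bilinear_relations.add_left[OF assms]] assms
  by (simp add: pure_tensor_def T_simps)

lemma tens_add_right:
  assumes "a \<in> carrier A" "b \<in> carrier B" "b' \<in> carrier B"
  shows "a \<boxtimes> (b \<oplus>\<^bsub>B\<^esub> b') = a \<boxtimes> b \<oplus>\<^bsub>T\<^esub> a \<boxtimes> b'"
  using coset_eqI[OF bilinear_relations.add_right[OF assms]] assms
  by (simp add: pure_tensor_def T_simps)

lemma tens_smult_left:
  assumes "c \<in> carrier F" "a \<in> carrier A" "b \<in> carrier B"
  shows "(c \<odot>\<^bsub>A\<^esub> a) \<boxtimes> b = c \<odot>\<^bsub>T\<^esub> (a \<boxtimes> b)"
  using coset_eqI[OF bilinear_relations.smult_left[OF assms]] assms
  by (simp add: pure_tensor_def T_simps)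

lemma tens_smult_right:
  assumes "c \<in> carrier F" "a \<in> carrier A" "b \<in> carrier B"
  shows "a \<boxtimes> (c \<odot>\<^bsub>B\<^esub> b) = c \<odot>\<^bsub>T\<^esub> (a \<boxtimes> b)"
  using coset_eqI[OF bilinear_relations.smult_right[OF assms]] assms
  by (simp add: pure_tensor_def T_simps)

lemma tens_mult:
  assumes "a \<in> carrier A" "b \<in> carrier B" "a' \<in> carrier A" "b' \<in> carrier B"
  shows "(a \<boxtimes> b) \<otimes>\<^bsub>T\<^esub> (a' \<boxtimes> b') = (a \<otimes>\<^bsub>A\<^esub> a') \<boxtimes> (b \<otimes>\<^bsub>B\<^esub> b')"
  using assms by (simp add: pure_tensor_def T_simps basis_mult_P)

lemma T_one: "\<one>\<^bsub>T\<^esub> = \<one>\<^bsub>A\<^esub> \<boxtimes> \<one>\<^bsub>B\<^esub>"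
proof -
  have "\<one>\<^bsub>P\<^esub> = basis_elem F (\<one>\<^bsub>A\<^esub>, \<one>\<^bsub>B\<^esub>)" unfolding P_eq MA.S_simps by simp
  then show ?thesis unfolding T_eq P.quotient_algebra_simps by (simp add: pure_tensor_def)
qed

text \<open>
  Every tensor is a sum of pure tensors, without coefficients: a scalar is moved into the left factor.
\<close>
lemma T_induct [consumes 1, case_names zero add]:
  assumes "t \<in> carrier T" and zero: "Q \<zero>\<^bsub>T\<^esub>"
    and add: "\<And>a b t. \<lbrakk>a \<in> carrier A; b \<in> carrier B; t \<in> carrier T; Q t\<rbrakk> \<Longrightarrow> Q (a \<boxtimes> b \<oplus>\<^bsub>T\<^esub> t)"
  shows "Q t"
proof -
  obtain f where f: "f \<in> carrier P" "t = N +>\<^bsub>P\<^esub> f"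
    using P.quotient_algebra_cases[of t N, folded T_eq, OF assms(1)] .
  have "Q (N +>\<^bsub>P\<^esub> f)" using f(1) unfolding P_eq
  proof (induction rule: MA.S_induct)
    case zero
    have "\<zero>\<^bsub>T\<^esub> = N" unfolding T_eq P.quotient_algebra_simps ..
    then show ?case using \<open>Q \<zero>\<^bsub>T\<^esub>\<close> T_simps(5)[OF P.M.zero_closed] by (simp add: P_eq[symmetric])
  next
    case (add c p f)
    obtain a b where p: "p = (a, b)" "a \<in> carrier A" "b \<in> carrier B" using add by auto
    have "Q ((c \<odot>\<^bsub>A\<^esub> a) \<boxtimes> b \<oplus>\<^bsub>T\<^esub> (N +>\<^bsub>P\<^esub> f))"
      using add p by (intro assms(3)) (auto simp: P_eq[symmetric] T_simps)
    moreover have "(c \<odot>\<^bsub>A\<^esub> a) \<boxtimes> b = N +>\<^bsub>P\<^esub> (c \<odot>\<^bsub>P\<^esub> basis_elem F (a, b))"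
      using tens_smult_left[of c a b] add p by (simp add: pure_tensor_def T_simps)
    ultimately show ?case using add p unfolding P_eq[symmetric] by (simp add: T_simps)
  qed
  then show ?thesis using f by simp
qed

end

section \<open>Tensors with a central image\<close>

lemma algebra_homD:
  assumes "\<phi> \<in> algebra_hom F A B"
  shows "x \<in> carrier A \<Longrightarrow> \<phi> x \<in> carrier B"
    and "x \<in> carrier A \<Longrightarrow> y \<in> carrier A \<Longrightarrow> \<phi> (x \<otimes>\<^bsub>A\<^esub> y) = \<phi> x \<otimes>\<^bsub>B\<^esub> \<phi> y"
    and "x \<in> carrier A \<Longrightarrow> y \<in> carrier A \<Longrightarrow> \<phi> (x \<oplus>\<^bsub>A\<^esub> y) = \<phi> x \<oplus>\<^bsub>B\<^esub> \<phi> y"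
    and "c \<in> carrier F \<Longrightarrow> x \<in> carrier A \<Longrightarrow> \<phi> (c \<odot>\<^bsub>A\<^esub> x) = c \<odot>\<^bsub>B\<^esub> \<phi> x"
  using assms by (auto simp: algebra_hom_def hom_def)

context assoc_algebra
begin

lemma algebra_hom_zero:
  assumes "assoc_algebra F B" "\<phi> \<in> algebra_hom F A B"
  shows "\<phi> \<zero>\<^bsub>A\<^esub> = \<zero>\<^bsub>B\<^esub>"
proof -
  interpret B: assoc_algebra F B by fact
  show ?thesis
    using algebra_homD(4)[OF assms(2) R.zero_closed M.zero_closed]
      algebra_homD(1)[OF assms(2) M.zero_closed] by simp
qed

text \<open>
  The definition of central stability is about surjective homomorphisms; passing to the image makes
  it applicable to an arbitrary homomorphism.
\<close>
lemma assoc_algebra_image: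
  assumes "assoc_algebra F B" "\<phi> \<in> algebra_hom F A B"
  shows "assoc_algebra F (B\<lparr>carrier := \<phi> ` carrier A\<rparr>)" (is "assoc_algebra F ?C")
proof -
  interpret B: assoc_algebra F B by fact
  note hom = algebra_homD[OF assms(2)]
  have zero: "\<phi> \<zero>\<^bsub>A\<^esub> = \<zero>\<^bsub>B\<^esub>" by (rule algebra_hom_zero[OF assms])
  have closed: "x \<oplus>\<^bsub>B\<^esub> y \<in> \<phi> ` carrier A" "x \<otimes>\<^bsub>B\<^esub> y \<in> \<phi> ` carrier A" "c \<odot>\<^bsub>B\<^esub> x \<in> \<phi> ` carrier A"
    if "x \<in> \<phi> ` carrier A" "y \<in> \<phi> ` carrier A" "c \<in> carrier F" for x y c
    using that by (auto simp: hom(2-4)[symmetric] mult_closed)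
  have sub: "x \<in> carrier B" if "x \<in> \<phi> ` carrier A" for x using that hom(1) by auto
  have "abelian_group ?C"
  proof (rule abelian_groupI)
    fix x assume "x \<in> carrier ?C"
    then obtain a where a: "a \<in> carrier A" "x = \<phi> a" by auto
    have "\<phi> (\<ominus>\<^bsub>A\<^esub> a) \<oplus>\<^bsub>B\<^esub> \<phi> a = \<zero>\<^bsub>B\<^esub>"
      using a by (simp add: hom(3)[symmetric] M.l_neg zero)
    then show "\<exists>y\<in>carrier ?C. y \<oplus>\<^bsub>?C\<^esub> x = \<zero>\<^bsub>?C\<^esub>" using a by auto
  next
    show "\<zero>\<^bsub>?C\<^esub> \<in> carrier ?C" using zero by force
  qed (use closed[OF _ _ R.zero_closed] sub in \<open>auto simp: B.M.a_ac\<close>)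
  then have "module F ?C"
    using closed(3) sub
    by (intro moduleI)
      (auto simp: B.smult_l_distr B.smult_r_distr B.smult_assoc1 R.is_cring hom(1))
  then show ?thesis
    using closed(2)[OF _ _ R.zero_closed] sub
    by (intro assoc_algebra.intro assoc_algebra_axioms.intro field_axioms)
      (auto simp: B.mult_assoc B.mult_l_distr B.mult_r_distr B.smult_mult_left B.smult_mult_right hom(1))
qed

end

text \<open>
  Linear independence of a list in triangular form: each vector is outside the span of the later
  ones. Over a field this is the usual notion, but extending a list at the front or removing its
  first vector needs no argument.
\<close>
fun lin_indep :: "('f, 'r) ring_scheme \<Rightarrow> ('f, 'a, 'm) module_scheme \<Rightarrow> 'a list \<Rightarrow> bool" where
  "lin_indep F A [] \<longleftrightarrow> True"
| "lin_indep F A (x # xs) \<longleftrightarrow> x \<notin> lin_span F A xs \<and> lin_indep F A xs"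

context tensor_product
begin

interpretation T: unital_algebra F T by (rule T_algebra)
interpretation TR: ring T by (rule T.ring_A)

definition tsum where "tsum ps = foldr (\<lambda>(a, b) t. a \<boxtimes> b \<oplus>\<^bsub>T\<^esub> t) ps \<zero>\<^bsub>T\<^esub>"

lemma tsum_simps [simp]: "tsum [] = \<zero>\<^bsub>T\<^esub>" "tsum ((a, b) # ps) = a \<boxtimes> b \<oplus>\<^bsub>T\<^esub> tsum ps"
  by (simp_all add: tsum_def)

lemma tsum_closed [simp, intro]: "set ps \<subseteq> carrier A \<times> carrier B \<Longrightarrow> tsum ps \<in> carrier T"
  by (induction ps) auto

lemma tens_zero:
  shows "a \<in> carrier A \<Longrightarrow> a \<boxtimes> \<zero>\<^bsub>B\<^esub> = \<zero>\<^bsub>T\<^esub>" "b \<in> carrier B \<Longrightarrow> \<zero>\<^bsub>A\<^esub> \<boxtimes> b = \<zero>\<^bsub>T\<^esub>"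
  using tens_smult_right[OF A.R.zero_closed _ B.M.zero_closed] tens_smult_left[OF A.R.zero_closed A.M.zero_closed]
  by auto

lemma tsum_append:
  assumes "set ps \<subseteq> carrier A \<times> carrier B" "set qs \<subseteq> carrier A \<times> carrier B"
  shows "tsum (ps @ qs) = tsum ps \<oplus>\<^bsub>T\<^esub> tsum qs"
  using assms by (induction ps) (auto simp: T.M.a_assoc)

text \<open>
  If \<open>b\<close> depends linearly on the right factors of a sum, then \<open>a \<otimes> b\<close> is absorbed by changing only
  the left factors: the coefficients of \<open>b\<close> move across the tensor sign.
\<close>
lemma tsum_absorb:
  assumes "a \<in> carrier A" "set qs \<subseteq> carrier A \<times> carrier B" "b \<in> lin_span F B (map snd qs)"
  shows "\<exists>qs'. map snd qs' = map snd qs \<and> set qs' \<subseteq> carrier A \<times> carrier B \<and>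
    a \<boxtimes> b \<oplus>\<^bsub>T\<^esub> tsum qs = tsum qs'"
  using assms(2,3)
proof (induction qs arbitrary: b)
  case Nil
  then show ?case using assms(1) by (simp add: tens_zero)
next
  case (Cons q qs)
  obtain x y where q: "q = (x, y)" "x \<in> carrier A" "y \<in> carrier B" using Cons.prems by auto
  obtain c v where cv: "c \<in> carrier F" "v \<in> lin_span F B (map snd qs)" "b = c \<odot>\<^bsub>B\<^esub> y \<oplus>\<^bsub>B\<^esub> v"
    using Cons.prems q by auto
  have "set (map snd qs) \<subseteq> carrier B" using Cons.prems(1) by auto
  then have "v \<in> carrier B" using B.lin_span_subset cv(2) by blast
  obtain qs' where qs': "map snd qs' = map snd qs" "set qs' \<subseteq> carrier A \<times> carrier B"
    "a \<boxtimes> v \<oplus>\<^bsub>T\<^esub> tsum qs = tsum qs'"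
    using Cons.IH[OF _ cv(2)] Cons.prems(1) by auto
  have "a \<boxtimes> b = (c \<odot>\<^bsub>A\<^esub> a) \<boxtimes> y \<oplus>\<^bsub>T\<^esub> a \<boxtimes> v"
    using assms(1) q cv \<open>v \<in> carrier B\<close> by (simp add: tens_add_right tens_smult_left tens_smult_right)
  then have "a \<boxtimes> b \<oplus>\<^bsub>T\<^esub> tsum (q # qs) = (c \<odot>\<^bsub>A\<^esub> a \<oplus>\<^bsub>A\<^esub> x) \<boxtimes> y \<oplus>\<^bsub>T\<^esub> (a \<boxtimes> v \<oplus>\<^bsub>T\<^esub> tsum qs)"
    using assms(1) q cv(1) \<open>v \<in> carrier B\<close> Cons.prems(1)
    by (simp add: tens_add_left T.M.a_ac)
  then show ?case using qs' q assms(1) cv(1)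
    by (intro exI[of _ "(c \<odot>\<^bsub>A\<^esub> a \<oplus>\<^bsub>A\<^esub> x, y) # qs'"]) auto
qed

text \<open>
  Pure tensors are added one at a time: a right factor that depends on those already present is
  absorbed, any other is put in front. Starting with the summand \<open>0 \<otimes> 1\<close> keeps the unit of \<open>B\<close> as the
  last right factor.
\<close>
lemma normal_form:
  assumes one: "\<one>\<^bsub>B\<^esub> \<noteq> \<zero>\<^bsub>B\<^esub>" and "t \<in> carrier T"
  shows "\<exists>ps. \<exists>a\<in>carrier A. set ps \<subseteq> carrier A \<times> carrier B \<and>
    lin_indep F B (map snd ps @ [\<one>\<^bsub>B\<^esub>]) \<and> t = tsum (ps @ [(a, \<one>\<^bsub>B\<^esub>)])"
proof -
  have "\<exists>qs. set qs \<subseteq> carrier A \<times> carrier B \<and> lin_indep F B (map snd qs) \<and>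
    (\<exists>bs. map snd qs = bs @ [\<one>\<^bsub>B\<^esub>]) \<and> t = tsum qs"
    using assms(2)
  proof (induction rule: T_induct)
    case zero
    show ?case using one by (intro exI[of _ "[(\<zero>\<^bsub>A\<^esub>, \<one>\<^bsub>B\<^esub>)]"]) (simp add: tens_zero)
  next
    case (add a b t)
    then obtain qs bs where qs: "set qs \<subseteq> carrier A \<times> carrier B" "lin_indep F B (map snd qs)"
      "map snd qs = bs @ [\<one>\<^bsub>B\<^esub>]" "t = tsum qs" by blast
    show ?case
    proof (cases "b \<in> lin_span F B (map snd qs)")
      case True
      then show ?thesis using tsum_absorb[OF add(1) qs(1) True] qs by metis
    next
      case False
      then show ?thesis using qs add by (intro exI[of _ "(a, b) # qs"]) auto
    qed
  qed
  then obtain qs bs where qs: "set qs \<subseteq> carrier A \<times> carrier B" "lin_indep F B (map snd qs)"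
      "map snd qs = bs @ [\<one>\<^bsub>B\<^esub>]" "t = tsum qs" by blast
  then obtain ps a where "qs = ps @ [(a, \<one>\<^bsub>B\<^esub>)]"
    by (auto simp: map_eq_append_conv)
  with qs show ?thesis by (intro exI[of _ ps] bexI[of _ a]) auto
qed

lemma map_apsnd_closed:
  assumes "set ps \<subseteq> carrier A \<times> carrier B" "m \<in> mult_ops B"
  shows "set (map (apsnd m) ps) \<subseteq> carrier A \<times> carrier B"
  using assms(1) B.mult_ops_closed[OF assms(2)] by auto

lemma tsum_map_mult:
  assumes "set ps \<subseteq> carrier A \<times> carrier B" "m \<in> mult_ops B" "x \<in> carrier B"
  shows "tsum (map (apsnd (\<lambda>b. x \<otimes>\<^bsub>B\<^esub> m b)) ps) = (\<one>\<^bsub>A\<^esub> \<boxtimes> x) \<otimes>\<^bsub>T\<^esub> tsum (map (apsnd m) ps)"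
    and "tsum (map (apsnd (\<lambda>b. m b \<otimes>\<^bsub>B\<^esub> x)) ps) = tsum (map (apsnd m) ps) \<otimes>\<^bsub>T\<^esub> (\<one>\<^bsub>A\<^esub> \<boxtimes> x)"
proof -
  show "tsum (map (apsnd (\<lambda>b. x \<otimes>\<^bsub>B\<^esub> m b)) ps) = (\<one>\<^bsub>A\<^esub> \<boxtimes> x) \<otimes>\<^bsub>T\<^esub> tsum (map (apsnd m) ps)"
    using assms(1)
  proof (induction ps)
    case (Cons p ps)
    then show ?case using map_apsnd_closed[OF _ assms(2), of ps] assms(3) B.mult_ops_closed[OF assms(2)]
      by (cases p) (simp add: TR.r_distr tens_mult)
  qed (use assms in simp)
  show "tsum (map (apsnd (\<lambda>b. m b \<otimes>\<^bsub>B\<^esub> x)) ps) = tsum (map (apsnd m) ps) \<otimes>\<^bsub>T\<^esub> (\<one>\<^bsub>A\<^esub> \<boxtimes> x)"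
    using assms(1)
  proof (induction ps)
    case (Cons p ps)
    then show ?case using map_apsnd_closed[OF _ assms(2), of ps] assms(3) B.mult_ops_closed[OF assms(2)]
      by (cases p) (simp add: TR.l_distr tens_mult)
  qed (use assms in simp)
qed

lemma tsum_map_add:
  assumes "set ps \<subseteq> carrier A \<times> carrier B" "m \<in> mult_ops B" "m' \<in> mult_ops B"
  shows "tsum (map (apsnd (\<lambda>b. m b \<oplus>\<^bsub>B\<^esub> m' b)) ps) =
    tsum (map (apsnd m) ps) \<oplus>\<^bsub>T\<^esub> tsum (map (apsnd m') ps)"
  using assms(1)
proof (induction ps)
  case (Cons p ps)
  then have "set ps \<subseteq> carrier A \<times> carrier B" by simp
  then have "tsum (map (apsnd m) ps) \<in> carrier T" "tsum (map (apsnd m') ps) \<in> carrier T"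
    using map_apsnd_closed assms(2,3) by (metis tsum_closed)+
  with Cons show ?case using B.mult_ops_closed[OF assms(2)] B.mult_ops_closed[OF assms(3)]
    by (cases p) (simp add: tens_add_right T.M.a_ac)
qed simp

text \<open>
  The operator \<open>id \<otimes> m\<close> on the tensor product is a combination of left and right multiplications by
  elements \<open>1 \<otimes> x\<close>. Modulo the kernel of \<open>\<phi>\<close> the tensor commutes with these, so all of them can be
  collected on one side, where they combine to \<open>1 \<otimes> m(1)\<close>.
\<close>
lemma mult_ops_central:
  assumes C: "assoc_algebra F C" and \<phi>: "\<phi> \<in> algebra_hom F T C"
    and ps: "set ps \<subseteq> carrier A \<times> carrier B"
    and central: "\<phi> (tsum ps) \<in> center C" and m: "m \<in> mult_ops B"
  shows "\<phi> (tsum (map (apsnd m) ps)) = \<phi> (tsum ps) \<otimes>\<^bsub>C\<^esub> \<phi> (\<one>\<^bsub>A\<^esub> \<boxtimes> m \<one>\<^bsub>B\<^esub>)"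
proof -
  interpret C: assoc_algebra F C by fact
  note hom = algebra_homD[OF \<phi>]
  have t: "\<phi> (tsum ps) \<in> carrier C" using hom(1) ps by auto
  have comm: "c \<otimes>\<^bsub>C\<^esub> \<phi> (tsum ps) = \<phi> (tsum ps) \<otimes>\<^bsub>C\<^esub> c" if "c \<in> carrier C" for c
    using central that by (auto simp: center_def)
  show ?thesis using m
  proof (induction m rule: mult_ops.induct)
    case ident
    have "map (apsnd (\<lambda>b. b)) ps = ps" by (induction ps) auto
    then show ?case using ps by (simp add: hom(2)[symmetric] T_one[symmetric])
  next
    case (left x m)
    note closed = B.mult_ops_closed[OF left(2) B.one_closed] map_apsnd_closed[OF ps left(2)]
    let ?x = "\<phi> (\<one>\<^bsub>A\<^esub> \<boxtimes> x)" and ?m = "\<phi> (\<one>\<^bsub>A\<^esub> \<boxtimes> m \<one>\<^bsub>B\<^esub>)"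
    have c: "?x \<in> carrier C" "?m \<in> carrier C" using hom(1) closed left by auto
    have "\<phi> (tsum (map (apsnd (\<lambda>b. x \<otimes>\<^bsub>B\<^esub> m b)) ps)) = ?x \<otimes>\<^bsub>C\<^esub> (\<phi> (tsum ps) \<otimes>\<^bsub>C\<^esub> ?m)"
      using left closed tsum_closed[OF closed(2)] by (simp add: tsum_map_mult(1)[OF ps] hom(2))
    also have "\<dots> = \<phi> (tsum ps) \<otimes>\<^bsub>C\<^esub> (?x \<otimes>\<^bsub>C\<^esub> ?m)"
      using c t by (simp add: C.mult_assoc[symmetric] comm)
    also have "?x \<otimes>\<^bsub>C\<^esub> ?m = \<phi> (\<one>\<^bsub>A\<^esub> \<boxtimes> (x \<otimes>\<^bsub>B\<^esub> m \<one>\<^bsub>B\<^esub>))"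
      using left closed by (simp add: hom(2)[symmetric] tens_mult)
    finally show ?case .
  next
    case (right x m)
    note closed = B.mult_ops_closed[OF right(2) B.one_closed] map_apsnd_closed[OF ps right(2)]
    let ?x = "\<phi> (\<one>\<^bsub>A\<^esub> \<boxtimes> x)" and ?m = "\<phi> (\<one>\<^bsub>A\<^esub> \<boxtimes> m \<one>\<^bsub>B\<^esub>)"
    have c: "?x \<in> carrier C" "?m \<in> carrier C" using hom(1) closed right by auto
    have "\<phi> (tsum (map (apsnd (\<lambda>b. m b \<otimes>\<^bsub>B\<^esub> x)) ps)) = (\<phi> (tsum ps) \<otimes>\<^bsub>C\<^esub> ?m) \<otimes>\<^bsub>C\<^esub> ?x"
      using right closed tsum_closed[OF closed(2)] by (simp add: tsum_map_mult(2)[OF ps] hom(2))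
    also have "\<dots> = \<phi> (tsum ps) \<otimes>\<^bsub>C\<^esub> (?m \<otimes>\<^bsub>C\<^esub> ?x)"
      using c t by (simp add: C.mult_assoc)
    also have "?m \<otimes>\<^bsub>C\<^esub> ?x = \<phi> (\<one>\<^bsub>A\<^esub> \<boxtimes> (m \<one>\<^bsub>B\<^esub> \<otimes>\<^bsub>B\<^esub> x))"
      using right closed by (simp add: hom(2)[symmetric] tens_mult)
    finally show ?case .
  next
    case (sum m m')
    note closed = B.mult_ops_closed[OF sum(1) B.one_closed] B.mult_ops_closed[OF sum(2) B.one_closed]
      tsum_closed[OF map_apsnd_closed[OF ps sum(1)]]
      tsum_closed[OF map_apsnd_closed[OF ps sum(2)]]
    then show ?case using sum t
      by (simp add: tsum_map_add[OF ps] hom(1,3) tens_add_right C.mult_r_distr)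
  qed
qed

text \<open>
  Density provides an operator \<open>m\<close> that sends the first right factor to \<open>1\<close> and kills the others,
  among them the unit of \<open>B\<close>. Applied to the tensor it leaves \<open>x \<otimes> 1\<close>, where \<open>x\<close> is the first left
  factor, and by the preceding lemma this has the image \<open>\<phi>(t) \<phi>(1 \<otimes> m(1)) = 0\<close>. So the first summand
  disappears under \<open>\<phi>\<close>; the remaining tensor has the same central image, and the argument repeats.
\<close>
lemma central_image_imp_zero:
  assumes csa: "central_simple_algebra F B"
    and C: "assoc_algebra F C" and \<phi>: "\<phi> \<in> algebra_hom F T C"
    and a: "a \<in> carrier A" and ps: "set ps \<subseteq> carrier A \<times> carrier B"
    and indep: "lin_indep F B (map snd ps @ [\<one>\<^bsub>B\<^esub>])"
    and central: "\<phi> (tsum (ps @ [(a, \<one>\<^bsub>B\<^esub>)])) \<in> center C"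
  shows "\<phi> (tsum ps) = \<zero>\<^bsub>C\<^esub>"
  using ps indep central
proof (induction ps)
  case Nil
  then show ?case using T.algebra_hom_zero[OF C \<phi>] by simp
next
  case (Cons p ps)
  interpret C: assoc_algebra F C by fact
  note hom = algebra_homD[OF \<phi>]
  obtain x b where p: "p = (x, b)" "x \<in> carrier A" "b \<in> carrier B" using Cons.prems(1) by auto
  let ?qs = "ps @ [(a, \<one>\<^bsub>B\<^esub>)]"
  have ps: "set ps \<subseteq> carrier A \<times> carrier B" and qs: "set ?qs \<subseteq> carrier A \<times> carrier B"
    and pqs: "set (p # ?qs) \<subseteq> carrier A \<times> carrier B" using Cons.prems a by auto
  have closed: "set (map snd ps @ [\<one>\<^bsub>B\<^esub>]) \<subseteq> carrier B" using ps by auto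
  have "b \<notin> lin_span F B (map snd ps @ [\<one>\<^bsub>B\<^esub>])" using Cons.prems(2) p(1) by simp
  from B.density[OF csa closed p(3) this]
  obtain m where m: "m \<in> mult_ops B" "\<forall>y\<in>set (map snd ps @ [\<one>\<^bsub>B\<^esub>]). m y = \<zero>\<^bsub>B\<^esub>" "m b = \<one>\<^bsub>B\<^esub>"
    by blast
  have "tsum (map (apsnd m) rs) = \<zero>\<^bsub>T\<^esub>"
    if "set rs \<subseteq> carrier A \<times> carrier B" "\<forall>y\<in>set (map snd rs). m y = \<zero>\<^bsub>B\<^esub>" for rs
    using that by (induction rs) (auto simp: tens_zero)
  from this[OF qs] have "tsum (map (apsnd m) (p # ?qs)) = x \<boxtimes> \<one>\<^bsub>B\<^esub>"
    using m p by simp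
  then have "\<phi> (x \<boxtimes> \<one>\<^bsub>B\<^esub>) = \<phi> (tsum (p # ?qs)) \<otimes>\<^bsub>C\<^esub> \<phi> (\<one>\<^bsub>A\<^esub> \<boxtimes> m \<one>\<^bsub>B\<^esub>)"
    using mult_ops_central[OF C \<phi> pqs _ m(1)] Cons.prems(3) by simp
  moreover have "\<phi> (\<one>\<^bsub>A\<^esub> \<boxtimes> m \<one>\<^bsub>B\<^esub>) = \<zero>\<^bsub>C\<^esub>"
    using m(2) by (simp add: tens_zero T.algebra_hom_zero[OF C \<phi>])
  moreover have null: "c \<otimes>\<^bsub>C\<^esub> \<zero>\<^bsub>C\<^esub> = \<zero>\<^bsub>C\<^esub>" "\<zero>\<^bsub>C\<^esub> \<otimes>\<^bsub>C\<^esub> c = \<zero>\<^bsub>C\<^esub>" if "c \<in> carrier C" for c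
    using C.smult_mult_right[OF A.R.zero_closed that C.M.zero_closed]
      C.smult_mult_left[OF A.R.zero_closed C.M.zero_closed that] that by (simp_all add: C.mult_closed)
  ultimately have "\<phi> (x \<boxtimes> \<one>\<^bsub>B\<^esub>) = \<zero>\<^bsub>C\<^esub>"
    using hom(1)[OF tsum_closed[OF pqs]] by simp
  moreover have "\<phi> (x \<boxtimes> b) = \<phi> (x \<boxtimes> \<one>\<^bsub>B\<^esub>) \<otimes>\<^bsub>C\<^esub> \<phi> (\<one>\<^bsub>A\<^esub> \<boxtimes> b)"
    using p by (simp add: hom(2)[symmetric] tens_mult)
  ultimately have xb: "\<phi> (x \<boxtimes> b) = \<zero>\<^bsub>C\<^esub>" using null hom(1) p by simp
  have drop: "\<phi> (tsum (p # rs)) = \<phi> (tsum rs)" if "set rs \<subseteq> carrier A \<times> carrier B" for rs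
    using that p xb hom(1) by (simp add: hom(3))
  show ?case
    using Cons.IH[OF ps] Cons.prems drop[OF ps] drop[OF qs] by simp
qed

section \<open>Central stability in tensor products\<close>

lemma center_tens:
  assumes z: "z \<in> center A"
  shows "z \<boxtimes> \<one>\<^bsub>B\<^esub> \<in> center T"
proof -
  have zc: "z \<in> carrier A" using z by (simp add: center_def)
  have "(z \<boxtimes> \<one>\<^bsub>B\<^esub>) \<otimes>\<^bsub>T\<^esub> t = t \<otimes>\<^bsub>T\<^esub> (z \<boxtimes> \<one>\<^bsub>B\<^esub>)" if "t \<in> carrier T" for t
    using that
  proof (induction rule: T_induct)
    case (add a b t)
    then show ?case using z zc by (simp add: TR.l_distr TR.r_distr tens_mult center_def)
  qed (use zc in simp)
  then show ?thesis using zc by (simp add: center_def)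
qed

lemma zero_center_T: "\<zero>\<^bsub>T\<^esub> \<in> center T"
  by (simp add: center_def)

lemma tens_hom:
  assumes \<phi>: "\<phi> \<in> algebra_hom F T C"
  shows "(\<lambda>x. \<phi> (x \<boxtimes> \<one>\<^bsub>B\<^esub>)) \<in> algebra_hom F A C"
  using algebra_homD[OF \<phi>]
  by (auto simp: algebra_hom_def hom_def tens_add_left tens_smult_left tens_mult simp flip: algebra_homD(2)[OF \<phi>])

text \<open>
  Any normal form of \<open>t\<close> gives the decomposition. A homomorphism under which \<open>t\<close>, or \<open>s\<close> alone,
  becomes central kills \<open>s\<close>. For \<open>s\<close> this already is central stability; for \<open>t\<close> it reduces the
  question to the restriction of the homomorphism to \<open>A \<otimes> 1\<close>.
\<close>
lemma centrally_stable_decomposition: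
  assumes csa: "central_simple_algebra F B" and t: "t \<in> carrier T"
  shows "\<exists>a\<in>carrier A. \<exists>s\<in>carrier T. t = a \<boxtimes> \<one>\<^bsub>B\<^esub> \<oplus>\<^bsub>T\<^esub> s \<and> centrally_stable F T s \<and>
    (centrally_stable F A a \<longrightarrow> centrally_stable F T t)"
proof -
  interpret BR: ring B by (rule B.ring_A)
  obtain x y where xy: "x \<in> carrier B" "y \<in> carrier B" "x \<otimes>\<^bsub>B\<^esub> y \<noteq> \<zero>\<^bsub>B\<^esub>"
    using csa by (auto simp: central_simple_algebra_def simple_algebra_def)
  have "\<one>\<^bsub>B\<^esub> \<noteq> \<zero>\<^bsub>B\<^esub>"
  proof
    assume "\<one>\<^bsub>B\<^esub> = \<zero>\<^bsub>B\<^esub>"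
    then have "\<zero>\<^bsub>B\<^esub> \<otimes>\<^bsub>B\<^esub> x = x" using B.l_one[OF xy(1)] by (simp only:)
    then have "x = \<zero>\<^bsub>B\<^esub>" using xy(1) by simp
    with xy show False by simp
  qed
  then obtain ps a where a: "a \<in> carrier A" and ps: "set ps \<subseteq> carrier A \<times> carrier B"
    and indep: "lin_indep F B (map snd ps @ [\<one>\<^bsub>B\<^esub>])" and t_eq: "t = tsum (ps @ [(a, \<one>\<^bsub>B\<^esub>)])"
    using normal_form[OF _ t] by blast
  define s where "s = tsum ps"
  have s: "s \<in> carrier T" using ps by (simp add: s_def)
  have sum: "tsum (ps @ [(a', \<one>\<^bsub>B\<^esub>)]) = a' \<boxtimes> \<one>\<^bsub>B\<^esub> \<oplus>\<^bsub>T\<^esub> s" if "a' \<in> carrier A" for a'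
    using that ps s by (simp add: tsum_append s_def T.M.a_comm)
  \<comment> \<open>The coefficient of \<open>1\<close> is left free: \<open>a' = a\<close> is the case of \<open>t\<close>, and \<open>a' = 0\<close> that of \<open>s\<close>.\<close>
  have zero: "\<phi> s = \<zero>\<^bsub>C\<^esub>"
    if "assoc_algebra F C" "\<phi> \<in> algebra_epi F T C" "a' \<in> carrier A"
      "\<phi> (a' \<boxtimes> \<one>\<^bsub>B\<^esub> \<oplus>\<^bsub>T\<^esub> s) \<in> center C"
    for C :: "('f, ('a \<times> 'b \<Rightarrow> 'f) set set) module" and \<phi> a'
    using central_image_imp_zero[OF csa that(1) _ that(3) ps indep] that(2,4) sum[OF that(3)]
    by (simp add: s_def algebra_epi_def)
  have "centrally_stable F T s"
    unfolding centrally_stable_def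
  proof (intro conjI allI impI s, elim conjE)
    fix C :: "('f, ('a \<times> 'b \<Rightarrow> 'f) set set) module" and \<phi>
    assume "assoc_algebra F C" "\<phi> \<in> algebra_epi F T C" "\<phi> s \<in> center C"
    then have "\<phi> s = \<zero>\<^bsub>C\<^esub>"
      using zero[of C \<phi> "\<zero>\<^bsub>A\<^esub>"] s by (simp add: tens_zero)
    then have "s \<in> a_kernel T C \<phi>" using s by (simp add: a_kernel_def kernel_def)
    moreover have "s = \<zero>\<^bsub>T\<^esub> \<oplus>\<^bsub>T\<^esub> s" using s by simp
    ultimately show "s \<in> center T <+>\<^bsub>T\<^esub> a_kernel T C \<phi>"
      using zero_center_T unfolding set_add_def' by blast
  qed
  moreover have "centrally_stable F T t" if stable: "centrally_stable F A a"
    unfolding centrally_stable_def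
  proof (intro conjI allI impI t, elim conjE)
    fix C :: "('f, ('a \<times> 'b \<Rightarrow> 'f) set set) module" and \<phi>
    assume C: "assoc_algebra F C" and epi: "\<phi> \<in> algebra_epi F T C" and central: "\<phi> t \<in> center C"
    interpret C: assoc_algebra F C by fact
    have \<phi>: "\<phi> \<in> algebra_hom F T C" using epi by (simp add: algebra_epi_def)
    note hom = algebra_homD[OF \<phi>]
    have \<phi>s: "\<phi> s = \<zero>\<^bsub>C\<^esub>" using zero[OF C epi a] central sum[OF a] t_eq by simp
    define \<psi> where "\<psi> x = \<phi> (x \<boxtimes> \<one>\<^bsub>B\<^esub>)" for x
    have \<psi>: "\<psi> \<in> algebra_hom F A C" unfolding \<psi>_def by (rule tens_hom[OF \<phi>])
    \<comment> \<open>\<open>\<psi>\<close> is not onto \<open>C\<close> in general, so the stability of \<open>a\<close> is used for the image of \<open>\<psi>\<close>, where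
      \<open>\<psi> a\<close> is still central.\<close>
    let ?C' = "C\<lparr>carrier := \<psi> ` carrier A\<rparr>"
    have "\<phi> t = \<psi> a" using a s \<phi>s hom(1) by (simp add: t_eq sum hom(3) \<psi>_def)
    then have "\<psi> a \<in> center ?C'"
      using central a algebra_homD(1)[OF \<psi>] by (auto simp: center_def)
    moreover have "\<psi> \<in> algebra_epi F A ?C'"
      using \<psi> by (auto simp: algebra_epi_def algebra_hom_def hom_def)
    ultimately have "a \<in> center A <+>\<^bsub>A\<^esub> a_kernel A ?C' \<psi>"
      using centrally_stableD[OF stable A.assoc_algebra_image[OF C \<psi>]] by blast
    then obtain z k where z: "z \<in> center A" and k: "k \<in> carrier A" "\<psi> k = \<zero>\<^bsub>C\<^esub>" and a_eq: "a = z \<oplus>\<^bsub>A\<^esub> k"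
      by (auto simp: set_add_def' a_kernel_def kernel_def)
    have zc: "z \<in> carrier A" using z by (simp add: center_def)
    have "\<phi> (k \<boxtimes> \<one>\<^bsub>B\<^esub> \<oplus>\<^bsub>T\<^esub> s) = \<zero>\<^bsub>C\<^esub>"
      using k s \<phi>s by (simp add: hom(3) \<psi>_def)
    then have "k \<boxtimes> \<one>\<^bsub>B\<^esub> \<oplus>\<^bsub>T\<^esub> s \<in> a_kernel T C \<phi>" using k s by (simp add: a_kernel_def kernel_def)
    moreover have "t = z \<boxtimes> \<one>\<^bsub>B\<^esub> \<oplus>\<^bsub>T\<^esub> (k \<boxtimes> \<one>\<^bsub>B\<^esub> \<oplus>\<^bsub>T\<^esub> s)"
      using zc k s a by (simp add: t_eq sum) (simp add: a_eq tens_add_left T.M.a_assoc)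
    ultimately show "t \<in> center T <+>\<^bsub>T\<^esub> a_kernel T C \<phi>"
      using center_tens[OF z] unfolding set_add_def' by blast
  qed
  ultimately show ?thesis using a s sum[OF a] t_eq by (intro bexI[of _ a] bexI[of _ s]) simp_all
qed

end

theorem theorem3p4:
  fixes F :: "'f ring" and A :: "('f, 'a) module" and B :: "('f, 'b) module"
  assumes "unital_algebra F A"
    and "central_simple_algebra F B"
    and "t \<in> carrier (tensor_algebra F A B)"
  shows "\<exists>a \<in> carrier A. \<exists>s \<in> carrier (tensor_algebra F A B).
    t = pure_tensor F A B a \<one>\<^bsub>B\<^esub> \<oplus>\<^bsub>tensor_algebra F A B\<^esub> s \<and>
    centrally_stable F (tensor_algebra F A B) s \<and>
    (centrally_stable F A a \<longrightarrow> centrally_stable F (tensor_algebra F A B) t)"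
proof -
  interpret tensor_product F A B
    using assms(1,2)
    by (auto simp: tensor_product_def central_simple_algebra_def central_algebra_def)
  show ?thesis by (rule centrally_stable_decomposition[OF assms(2,3)])
qed

end
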